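(* Let $N=2$, $m=1$, $0<p<1$, $0<L<\infty$, and let $u$ be a solution to $$u_t=\Delta u+\mathbf 1_{B_L}(x)\,u^p\quad\text{in }\mathbb R^2\times(0,\infty),\qquad u(x,0)=u_0(x).$$ Then $$u(x,t)\sim(\log t)^{\frac1{1-p}}\qquad\text{as }t\to\infty$$ uniformly for $x$ in compact subsets of $\mathbb R^2$.
   Context: $B_L=\{x\in\mathbb R^2:|x|<L\}$. The initial datum $u_0\in L^1(\mathbb R^2)\cap L^\infty(\mathbb R^2)$ is continuous, nonnegative and nontrivial, and strictly positive on $\overline{B_L}$ (to guarantee uniqueness). The solution is the unique nonnegative solution, bounded in $\mathbb R^2\times[0,t]$ for every $t>0$ (all solutions are global in this parameter range). The symbol $f\sim g$ uniformly on a compact set $K$, as $t\to\infty$, means that there are constants $0<c_1\le c_2<\infty$ (depending on $K$) with $c_1\le f/g\le c_2$ for all $x\in K$ and all large $t$. *)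

theory Defs
  imports "HOL-Analysis.Analysis"
begin

text \<open>
  Test functions: functions of class \<open>C\<^sup>2\<close> in space and \<open>C\<^sup>1\<close> in time on the closed strip
  \<open>\<real>\<^sup>2 \<times> [0,T]\<close> with compact support there; they need not vanish at \<open>t = 0\<close> or \<open>t = T\<close>.
  The (unique) derivatives are carried along as arguments: \<open>\<phi>'\<close> is the time derivative
  (one-sided at the end points), \<open>G\<close> the spatial gradient and \<open>H\<close> the spatial Hessian,
  so that \<open>trace (H x t)\<close> is the Laplacian of \<open>\<phi>\<close>.
\<close>

definition test_function ::
  "real \<Rightarrow> (real^2 \<Rightarrow> real \<Rightarrow> real) \<Rightarrow> (real^2 \<Rightarrow> real \<Rightarrow> real) \<Rightarrow>
    (real^2 \<Rightarrow> real \<Rightarrow> real^2) \<Rightarrow> (real^2 \<Rightarrow> real \<Rightarrow> real^2^2) \<Rightarrow> bool"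
where
  "test_function T \<phi> \<phi>' G H \<longleftrightarrow>
     (\<forall>x. \<forall>t\<in>{0..T}. (\<phi> x has_real_derivative \<phi>' x t) (at t within {0..T})) \<and>
     (\<forall>x. \<forall>t\<in>{0..T}. GDERIV (\<lambda>y. \<phi> y t) x :> G x t) \<and>
     (\<forall>x. \<forall>t\<in>{0..T}. ((\<lambda>y. G y t) has_derivative (\<lambda>h. H x t *v h)) (at x)) \<and>
     continuous_on (UNIV \<times> {0..T}) (\<lambda>(x, t). \<phi> x t) \<and>
     continuous_on (UNIV \<times> {0..T}) (\<lambda>(x, t). \<phi>' x t) \<and>
     continuous_on (UNIV \<times> {0..T}) (\<lambda>(x, t). G x t) \<and>
     continuous_on (UNIV \<times> {0..T}) (\<lambda>(x, t). H x t) \<and>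
     (\<exists>K. compact K \<and> (\<forall>x. \<forall>t\<in>{0..T}. x \<notin> K \<longrightarrow> \<phi> x t = 0))"

text \<open>
  Nonnegative solutions of \<open>u\<^sub>t = \<Delta>u + 1\<^bsub>B\<^sub>L\<^esub> u\<^sup>p\<close> in \<open>\<real>\<^sup>2 \<times> (0,\<infinity>)\<close> with \<open>u(\<cdot>,0) = u\<^sub>0\<close>, bounded on
  \<open>\<real>\<^sup>2 \<times> [0,T]\<close> for every \<open>T\<close>. The reaction coefficient jumps across \<open>|x| = L\<close>, so the equation is
  understood in the weak sense, for the continuous representative \<open>u\<close>. Only the values \<open>u x t\<close>
  with \<open>t \<ge> 0\<close> matter.
\<close>

definition bounded_solution ::
  "real \<Rightarrow> real \<Rightarrow> (real^2 \<Rightarrow> real) \<Rightarrow> (real^2 \<Rightarrow> real \<Rightarrow> real) \<Rightarrow> bool"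
where
  "bounded_solution p L u\<^sub>0 u \<longleftrightarrow>
     continuous_on (UNIV \<times> {0..}) (\<lambda>(x, t). u x t) \<and>
     (\<forall>x. \<forall>t\<ge>0. 0 \<le> u x t) \<and>
     (\<forall>T>0. bounded ((\<lambda>(x, t). u x t) ` (UNIV \<times> {0..T}))) \<and>
     (\<forall>x. u x 0 = u\<^sub>0 x) \<and>
     (\<forall>T>0. \<forall>\<phi> \<phi>' G H. test_function T \<phi> \<phi>' G H \<longrightarrow>
        (LINT x|lborel. u x T * \<phi> x T) - (LINT x|lborel. u\<^sub>0 x * \<phi> x 0) =
        (LINT t:{0..T}|lborel. (LINT x|lborel.
           u x t * (\<phi>' x t + trace (H x t)) + indicator (ball 0 L) x * (u x t powr p) * \<phi> x t)))"

text \<open>\<open>f \<sim> g\<close> uniformly on \<open>K\<close> as \<open>t \<rightarrow> \<infinity>\<close>: the quotient is bounded above and below, it need not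
  tend to 1.\<close>

definition sim_uniformly_on ::
  "'a set \<Rightarrow> ('a \<Rightarrow> real \<Rightarrow> real) \<Rightarrow> ('a \<Rightarrow> real \<Rightarrow> real) \<Rightarrow> bool"
where
  "sim_uniformly_on K f g \<longleftrightarrow>
     (\<exists>c\<^sub>1 c\<^sub>2. 0 < c\<^sub>1 \<and> c\<^sub>1 \<le> c\<^sub>2 \<and>
        (\<forall>\<^sub>F t in at_top. \<forall>x\<in>K. c\<^sub>1 \<le> f x t / g x t \<and> f x t / g x t \<le> c\<^sub>2))"

end

theory Submission
  imports Defs "HOL-Probability.Distributions" "HOL-Real_Asymp.Real_Asymp"
begin

text \<open>
  The weak formulation is tested with \<open>h(K)\<close>, where \<open>K(y,s)\<close> is the backward heat kernel
  with pole slightly after the final time \<open>T\<close>, and \<open>h\<close> is a convex \<open>C\<^sup>2\<close> truncation vanishing on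
  \<open>[0,\<delta>]\<close>. Then \<open>h(K)\<close> has compact support, and \<open>(\<partial>\<^sub>s + \<Delta>) h(K) = h''(K) |\<nabla>K|\<^sup>2\<close> is nonnegative and
  tends to 0 with \<open>\<delta>\<close>. Letting the pole tend to \<open>(x,T)\<close> gives both inequalities of Duhamel's formula
  up to constant factors, which is all that is needed.

  Since \<open>\<integral>\<^bsub>B\<^sub>L\<^esub> K\<close> is of order \<open>1 / (1 + T - s)\<close>, the supremum \<open>M\<close> of \<open>u\<close> up to time \<open>T\<close> satisfies
  \<open>M \<le> C (1 + M\<^sup>p log T)\<close>, which is the upper bound. For the lower bound, if
  \<open>u \<ge> a (log s)\<^bsup>1/(1-p)\<^esup>\<close> for \<open>s\<close> in \<open>[T/2, T-1]\<close>, then the source over that time interval gives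
  \<open>u \<ge> c a\<^sup>p (log (T/2))\<^bsup>p/(1-p)\<^esup> log (T/2)\<close> at time \<open>T\<close>, so the bound with a small \<open>a\<close> propagates in
  time steps of length 1.
\<close>

subsection \<open>The truncated heat kernel\<close>

text \<open>The heat kernel of the plane up to the factor \<open>1 / (4 \<pi>)\<close>.\<close>
definition gauss :: "real \<Rightarrow> 'a::real_inner \<Rightarrow> real" where
  "gauss \<tau> z = exp (- (z \<bullet> z) / (4 * \<tau>)) / \<tau>"

text \<open>The cube makes the function C^2 across \<open>r = \<delta>\<close>. Dividing by
  \<open>r\<^sup>2\<close> restores linear growth: it stays between \<open>r / 8\<close> and
  \<open>r\<close> above \<open>2 * \<delta>\<close>, while the second derivative decays like the
  inverse cube of \<open>r\<close>.\<close>

definition trunc :: "real \<Rightarrow> real \<Rightarrow> real" where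
  "trunc \<delta> r = (max 0 (r - \<delta>))^3 / r\<^sup>2"

definition trunc' :: "real \<Rightarrow> real \<Rightarrow> real" where
  "trunc' \<delta> r = (max 0 (r - \<delta>))\<^sup>2 * (r + 2 * \<delta>) / r^3"

definition trunc'' :: "real \<Rightarrow> real \<Rightarrow> real" where
  "trunc'' \<delta> r = 6 * \<delta>\<^sup>2 * max 0 (r - \<delta>) / r^4"

lemma gauss_pos: "0 < \<tau> \<Longrightarrow> 0 < gauss \<tau> z"
  by (simp add: gauss_def)

lemma gauss_nonneg: "0 < \<tau> \<Longrightarrow> 0 \<le> gauss \<tau> z"
  by (simp add: gauss_def)

section \<open>Calculus of the truncation\<close>

text \<open>Away from \<open>\<delta>\<close> the function is locally zero or a polynomial. At
  \<open>\<delta>\<close> the exponent is at least 2, so the difference quotient is at most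
  \<open>\<bar>h\<bar>^(n+1)\<close> and the kink is invisible to the first derivative.\<close>

lemma DERIV_max_0_power:
  fixes r \<delta> :: real
  shows "((\<lambda>r. (max 0 (r - \<delta>))^(n + 2)) has_real_derivative real (n + 2) * (max 0 (r - \<delta>))^(n + 1)) (at r)"
proof (cases r \<delta> rule: linorder_cases)
  case less
  have ev: "\<forall>\<^sub>F x in nhds r. (max 0 (x - \<delta>))^(n + 2) = 0"
    using eventually_nhds_in_open[of "{..<\<delta>}" r] less by (auto elim!: eventually_mono)
  have eq: "real (n + 2) * (max 0 (r - \<delta>))^(n + 1) = 0"
    using less by simp
  show ?thesis
    unfolding eq by (subst DERIV_cong_ev[OF refl ev refl]) simp
next
  case greater
  have ev: "\<forall>\<^sub>F x in nhds r. (max 0 (x - \<delta>))^(n + 2) = (x - \<delta>)^(n + 2)"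
    using eventually_nhds_in_open[of "{\<delta><..}" r] greater by (auto elim!: eventually_mono)
  show ?thesis
    unfolding DERIV_cong_ev[OF refl ev refl] using greater
      DERIV_power[of "\<lambda>r. r - \<delta>" 1 r UNIV "n + 2"]
    by (auto intro!: derivative_eq_intros simp del: power_Suc)
next
  case equal
  have "((\<lambda>h. (max 0 h)^(n + 2) / h) \<longlongrightarrow> 0) (at (0::real))"
  proof (rule tendsto_rabs_zero_cancel, rule tendsto_sandwich[of "\<lambda>_. 0" _ _ "\<lambda>h. \<bar>h\<bar>^(n+1)"])
    have le: "\<bar>(max 0 h)^(n + 2) / h\<bar> \<le> \<bar>h\<bar>^(n+1)" for h :: real
    proof (cases "h > 0")
      case False
      then have "max 0 h = 0" by auto
      then have "\<bar>(max 0 h)^(n + 2) / h\<bar> = 0" by simp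
      then show ?thesis by (simp only: zero_le_power abs_ge_zero)
    qed (simp add: max.absorb2 abs_mult)
    show "\<forall>\<^sub>F h in at (0::real). \<bar>(max 0 h)^(n + 2) / h\<bar> \<le> \<bar>h\<bar>^(n+1)"
      by (intro always_eventually allI le)
  qed (auto intro!: tendsto_eq_intros)
  then show ?thesis
    using equal by (simp add: DERIV_def)
qed

lemma DERIV_trunc:
  assumes "0 < r"
  shows "(trunc \<delta> has_real_derivative trunc' \<delta> r) (at r)"
proof -
  have "((\<lambda>r. (max 0 (r - \<delta>))^3) has_real_derivative 3 * (max 0 (r - \<delta>))\<^sup>2) (at r)"
    using DERIV_max_0_power[of \<delta> 1 r] by (simp add: numeral_eq_Suc)
  moreover have "((\<lambda>r. r\<^sup>2) has_real_derivative 2 * r) (at r)"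
    by (auto intro!: derivative_eq_intros)
  ultimately have "(trunc \<delta> has_real_derivative
      (3 * (max 0 (r - \<delta>))\<^sup>2 * r\<^sup>2 - (max 0 (r - \<delta>))^3 * (2 * r)) / (r\<^sup>2 * r\<^sup>2)) (at r)"
    unfolding trunc_def[abs_def] using assms by (intro DERIV_divide) auto
  \<comment> \<open>Here \<open>m\<close> stands for \<open>max 0 (r - \<delta>)\<close>. The
    factored form is an identity on each of the two branches of the maximum, not for arbitrary
    \<open>m\<close>.\<close>
  moreover have "(3 * m\<^sup>2 * r\<^sup>2 - m^3 * (2 * r)) / (r\<^sup>2 * r\<^sup>2) = m\<^sup>2 * (r + 2 * \<delta>) / r^3"
    if "m = 0 \<or> \<delta> = r - m" for m
    using that assms by (auto simp: field_simps power2_eq_square power3_eq_cube)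
  ultimately show ?thesis
    unfolding trunc'_def by (cases "r \<le> \<delta>") auto
qed

lemma DERIV_trunc':
  assumes "0 < r"
  shows "(trunc' \<delta> has_real_derivative trunc'' \<delta> r) (at r)"
proof -
  have "((\<lambda>r. (max 0 (r - \<delta>))\<^sup>2) has_real_derivative 2 * max 0 (r - \<delta>)) (at r)"
    using DERIV_max_0_power[of \<delta> 0 r] by (simp add: numeral_eq_Suc)
  moreover have "((\<lambda>r. (r + 2 * \<delta>) / r^3) has_real_derivative
      (r^3 - (r + 2 * \<delta>) * (3 * r\<^sup>2)) / (r^3 * r^3)) (at r)"
    using assms by (auto intro!: derivative_eq_intros)
  ultimately have D: "((\<lambda>r. (max 0 (r - \<delta>))\<^sup>2 * ((r + 2 * \<delta>) / r^3)) has_real_derivative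
      2 * max 0 (r - \<delta>) * ((r + 2 * \<delta>) / r^3) +
      (r^3 - (r + 2 * \<delta>) * (3 * r\<^sup>2)) / (r^3 * r^3) * (max 0 (r - \<delta>))\<^sup>2) (at r)"
    by (rule DERIV_mult)
  have E: "2 * m * ((r + 2 * \<delta>) / r^3) +
      (r^3 - (r + 2 * \<delta>) * (3 * r\<^sup>2)) / (r^3 * r^3) * m\<^sup>2 = 6 * \<delta>\<^sup>2 * m / r^4"
    if "m = 0 \<or> \<delta> = r - m" for m
    using that assms
    by (auto simp: field_simps power2_eq_square power3_eq_cube power4_eq_xxxx)
  have "max 0 (r - \<delta>) = 0 \<or> \<delta> = r - max 0 (r - \<delta>)"
    by auto
  from DERIV_cong[OF D E[OF this]] show ?thesis
    unfolding trunc'_def[abs_def] trunc''_def by (simp only: times_divide_eq_right)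
qed

lemma trunc_nonneg: "0 < r \<Longrightarrow> 0 \<le> trunc \<delta> r"
  by (simp add: trunc_def)

lemma trunc_eq_0: "r \<le> \<delta> \<Longrightarrow> trunc \<delta> r = 0"
  by (simp add: trunc_def)

lemma trunc_le:
  assumes "0 < r" "0 \<le> \<delta>" shows "trunc \<delta> r \<le> r"
proof -
  have "(max 0 (r - \<delta>))^3 \<le> r^3"
    using assms by (intro power_mono) auto
  then show ?thesis
    using assms by (simp add: trunc_def field_simps power2_eq_square power3_eq_cube)
qed

lemma trunc_ge:
  assumes "0 < r" "2 * \<delta> \<le> r" shows "r / 8 \<le> trunc \<delta> r"
proof -
  have "(r/2)^3 \<le> (max 0 (r - \<delta>))^3"
    using assms by (intro power_mono) auto
  then show ?thesis
    using assms by (simp add: trunc_def field_simps power2_eq_square power3_eq_cube)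
qed

lemma trunc''_nonneg: "0 < r \<Longrightarrow> 0 \<le> trunc'' \<delta> r"
  by (simp add: trunc''_def)

lemma trunc''_eq_0: "r \<le> \<delta> \<Longrightarrow> trunc'' \<delta> r = 0"
  by (simp add: trunc''_def)

text \<open>Above \<open>\<delta>\<close> one has
  \<open>\<delta> * (r - \<delta>) \<le> r * r\<close>. The factor \<open>r\<^sup>2\<close> is what
  the squared gradient of a Gaussian contributes; the linear dependence on \<open>\<delta>\<close>
  is what makes the defect disappear in the limit.\<close>

lemma trunc''_le:
  assumes "0 < r" "0 < \<delta>" shows "trunc'' \<delta> r * r\<^sup>2 \<le> 6 * \<delta>"
proof (cases "r \<le> \<delta>")
  case False
  have "\<delta> * (r - \<delta>) \<le> r * r"
    using False assms by (intro mult_mono) auto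
  then have "6 * \<delta> * (\<delta> * (r - \<delta>)) \<le> 6 * \<delta> * (r * r)"
    using assms by (intro mult_left_mono) auto
  moreover have "trunc'' \<delta> r * r\<^sup>2 = 6 * \<delta> * (\<delta> * (r - \<delta>)) / (r * r)"
    using False assms by (simp add: trunc''_def field_simps power2_eq_square power4_eq_xxxx)
  ultimately show ?thesis
    using assms by (simp add: divide_le_eq)
qed (use assms in \<open>simp add: trunc''_eq_0\<close>)

section \<open>Derivatives of the Gaussian and of its truncation\<close>

lemma GDERIV_gauss:
  assumes "\<tau> > 0"
  shows "GDERIV (\<lambda>y. gauss \<tau> (y - x)) y :> - (gauss \<tau> (y - x) / (2 * \<tau>)) *\<^sub>R (y - x)"
  unfolding gauss_def gderiv_def using assms
  by (auto intro!: derivative_eq_intros simp: inner_commute power2_eq_square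
      inner_diff_right field_simps)

lemma DERIV_gauss_time:
  assumes "\<tau> > 0"
  shows "((\<lambda>\<tau>. gauss \<tau> z) has_real_derivative gauss \<tau> z * ((z \<bullet> z) / (4 * \<tau>\<^sup>2) - 1 / \<tau>)) (at \<tau>)"
  unfolding gauss_def using assms
  by (auto intro!: derivative_eq_intros simp: field_simps power2_eq_square)

text \<open>Chain rule: \<open>trunc''\<close> times the tensor square of the gradient
  \<open>- (gauss \<tau> z / (2 * \<tau>)) *\<^sub>R z\<close>, plus \<open>trunc'\<close> times the
  Hessian of the Gaussian.\<close>

definition trunc_gauss_hessian :: "real \<Rightarrow> real \<Rightarrow> real^2 \<Rightarrow> real^2^2" where
  "trunc_gauss_hessian \<delta> \<tau> z = (\<chi> i j. trunc'' \<delta> (gauss \<tau> z) * (gauss \<tau> z / (2 * \<tau>))\<^sup>2 * z $ i * z $ j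
     + trunc' \<delta> (gauss \<tau> z) * gauss \<tau> z * (z $ i * z $ j / (4 * \<tau>\<^sup>2) - mat 1 $ i $ j / (2 * \<tau>)))"

lemma trunc_gauss_hessian_mult:
  "trunc_gauss_hessian \<delta> \<tau> z *v h = (trunc'' \<delta> (gauss \<tau> z) * (gauss \<tau> z / (2 * \<tau>))\<^sup>2 * (h \<bullet> z)) *\<^sub>R z
     + (trunc' \<delta> (gauss \<tau> z) * gauss \<tau> z) *\<^sub>R (((h \<bullet> z) / (4 * \<tau>\<^sup>2)) *\<^sub>R z - (1 / (2 * \<tau>)) *\<^sub>R h)"
  unfolding vec_eq_iff matrix_vector_mult_def forall_2
  by (simp add: trunc_gauss_hessian_def mat_def sum_2 inner_vec_def algebra_simps add_divide_distrib)

text \<open>In dimension two the Laplacian of the Gaussian equals its derivative in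
  \<open>\<tau>\<close>. The term with \<open>trunc'\<close> is therefore cancelled by the time
  derivative of the test function, and only the term with \<open>trunc''\<close> survives.\<close>

lemma trace_trunc_gauss_hessian:
  "trace (trunc_gauss_hessian \<delta> \<tau> z) = trunc'' \<delta> (gauss \<tau> z) * (gauss \<tau> z)\<^sup>2 * (z \<bullet> z) / (4 * \<tau>\<^sup>2)
     + trunc' \<delta> (gauss \<tau> z) * (gauss \<tau> z * ((z \<bullet> z) / (4 * \<tau>\<^sup>2) - 1 / \<tau>))"
  by (simp add: trace_def trunc_gauss_hessian_def mat_def sum_2 inner_vec_def algebra_simps power2_eq_square add_divide_distrib)

text \<open>Take logarithms in
  \<open>\<delta> * \<tau> < exp (- (z \<bullet> z) / (4 * \<tau>))\<close>. Replacing
  \<open>\<tau>\<close> by its lower bound \<open>m\<close> inside the logarithm keeps the radius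
  under control uniformly in time.\<close>

lemma gauss_gt_imp:
  assumes "\<delta> < gauss \<tau> z" "0 < \<delta>" "0 < m" "m \<le> \<tau>"
  shows "z \<bullet> z \<le> - 4 * \<tau> * ln (\<delta> * m)"
proof -
  have "\<delta> * m \<le> \<delta> * \<tau>"
    using assms by simp
  also have "\<delta> * \<tau> \<le> exp (- (z \<bullet> z) / (4 * \<tau>))"
    using assms by (simp add: gauss_def less_divide_eq)
  finally have "ln (\<delta> * m) \<le> ln (exp (- (z \<bullet> z) / (4 * \<tau>)))"
    using assms by (subst ln_le_cancel_iff) auto
  then have "ln (\<delta> * m) \<le> - (z \<bullet> z) / (4 * \<tau>)"
    by (simp only: ln_exp)
  then show ?thesis
    using assms by (simp add: field_simps)
qed

text \<open>With the pole at \<open>S > T\<close> the kernel is smooth and positive on the whole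
  strip, and the truncation cuts it off where it drops below \<open>\<delta>\<close>.\<close>

lemma test_function_trunc_gauss:
  fixes x :: "real^2"
  assumes "T < S" "0 < \<delta>"
  shows "test_function T (\<lambda>y s. trunc \<delta> (gauss (S - s) (y - x)))
    (\<lambda>y s. - (trunc' \<delta> (gauss (S - s) (y - x)) * (gauss (S - s) (y - x) *
      (((y - x) \<bullet> (y - x)) / (4 * (S - s)\<^sup>2) - 1 / (S - s)))))
    (\<lambda>y s. - (trunc' \<delta> (gauss (S - s) (y - x)) * gauss (S - s) (y - x) / (2 * (S - s))) *\<^sub>R (y - x))
    (\<lambda>y s. trunc_gauss_hessian \<delta> (S - s) (y - x))"
    (is "test_function T ?\<phi> ?\<phi>' ?G ?H")
  unfolding test_function_def
proof (intro conjI allI ballI)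
  fix y t assume t: "t \<in> {0..T}"
  then have pos: "0 < S - t" and g: "0 < gauss (S - t) (y - x)"
    using assms by (auto intro: gauss_pos)
  have "((\<lambda>t. gauss (S - t) (y - x)) has_real_derivative
      gauss (S - t) (y - x) * (((y - x) \<bullet> (y - x)) / (4 * (S - t)\<^sup>2) - 1 / (S - t)) * -1) (at t)"
    by (rule DERIV_chain2[where f = "\<lambda>\<tau>. gauss \<tau> (y - x)" and g = "\<lambda>t. S - t", OF DERIV_gauss_time[OF pos]])
      (auto intro!: derivative_eq_intros)
  from DERIV_chain2[OF DERIV_trunc[OF g] this]
  show "(?\<phi> y has_real_derivative ?\<phi>' y t) (at t within {0..T})"
    by (auto intro: DERIV_subset)
  have dg: "((\<lambda>y. gauss (S - t) (y - x)) has_derivative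
      (\<lambda>h. - (gauss (S - t) (y - x) / (2 * (S - t))) * (h \<bullet> (y - x)))) (at y)"
    using GDERIV_gauss[OF pos, of x y] by (simp add: gderiv_def)
  from DERIV_compose_FDERIV[OF DERIV_trunc[OF g] dg]
  show "GDERIV (\<lambda>y. ?\<phi> y t) y :> ?G y t"
    by (simp add: gderiv_def mult_ac)
  show "((\<lambda>y. ?G y t) has_derivative (\<lambda>h. ?H y t *v h)) (at y)"
  proof (rule has_derivative_eq_rhs)
    \<comment> \<open>With \<open>c\<close> in place of the quotients, the comparison with the
      Hessian is a polynomial identity.\<close>
    define c where "c = 1 / (2 * (S - t))"
    have c: "a / (2 * (S - t)) = a * c" "a / (4 * (S - t)\<^sup>2) = a * c\<^sup>2" for a
      by (simp_all add: c_def power2_eq_square algebra_simps)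
    show "((\<lambda>y. ?G y t) has_derivative (\<lambda>h.
      - (trunc' \<delta> (gauss (S - t) (y - x)) * gauss (S - t) (y - x) * c) *\<^sub>R h +
      ((trunc'' \<delta> (gauss (S - t) (y - x)) * gauss (S - t) (y - x) + trunc' \<delta> (gauss (S - t) (y - x))) *
        (gauss (S - t) (y - x) * c) * (h \<bullet> (y - x)) * c) *\<^sub>R (y - x))) (at y)"
      unfolding c
      by (rule derivative_eq_intros dg[unfolded c] DERIV_compose_FDERIV[OF DERIV_trunc'[OF g] dg[unfolded c]] refl)+
        (simp add: fun_eq_iff algebra_simps)
    show "(\<lambda>h. - (trunc' \<delta> (gauss (S - t) (y - x)) * gauss (S - t) (y - x) * c) *\<^sub>R h +
      ((trunc'' \<delta> (gauss (S - t) (y - x)) * gauss (S - t) (y - x) + trunc' \<delta> (gauss (S - t) (y - x))) *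
        (gauss (S - t) (y - x) * c) * (h \<bullet> (y - x)) * c) *\<^sub>R (y - x)) = (\<lambda>h. ?H y t *v h)"
      unfolding trunc_gauss_hessian_mult c
      by (simp add: fun_eq_iff vec_eq_iff algebra_simps power2_eq_square)
  qed
next
  have nz: "0 < S - t" "S - t \<noteq> 0" "gauss (S - t) (y - x) \<noteq> 0" if "t \<in> {0..T}" for t and y :: "real^2"
    using assms that gauss_pos[of "S - t" "y - x"] by auto
  have g: "continuous_on (UNIV \<times> {0..T}) (\<lambda>w. gauss (S - snd w) (fst w - x))"
    unfolding gauss_def using nz(2) by (auto intro!: continuous_intros)
  have t: "continuous_on (UNIV \<times> {0..T}) (\<lambda>w. trunc \<delta> (gauss (S - snd w) (fst w - x)))"
    "continuous_on (UNIV \<times> {0..T}) (\<lambda>w. trunc' \<delta> (gauss (S - snd w) (fst w - x)))"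
    "continuous_on (UNIV \<times> {0..T}) (\<lambda>w. trunc'' \<delta> (gauss (S - snd w) (fst w - x)))"
    unfolding trunc_def trunc'_def trunc''_def
    using nz(3) by (auto intro!: continuous_intros g)
  show "continuous_on (UNIV \<times> {0..T}) (\<lambda>(y, t). ?\<phi> y t)"
    "continuous_on (UNIV \<times> {0..T}) (\<lambda>(y, t). ?\<phi>' y t)"
    "continuous_on (UNIV \<times> {0..T}) (\<lambda>(y, t). ?G y t)"
    "continuous_on (UNIV \<times> {0..T}) (\<lambda>(y, t). ?H y t)"
    unfolding case_prod_beta trunc_gauss_hessian_def using nz(2)
    by (auto intro!: continuous_intros g t continuous_on_vec_lambda)
  show "\<exists>K. compact K \<and> (\<forall>y. \<forall>t\<in>{0..T}. y \<notin> K \<longrightarrow> ?\<phi> y t = 0)"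
  \<comment> \<open>The radius comes from \<open>gauss_gt_imp\<close> with \<open>m = S - T\<close>
    and \<open>S - t \<le> S\<close>. The absolute value covers the case that
    \<open>\<delta> * (S - T)\<close> exceeds 1.\<close>
  proof (intro exI[of _ "cball x (sqrt (4 * S * \<bar>ln (\<delta> * (S - T))\<bar>))"] conjI allI ballI impI)
    fix y t assume y: "y \<notin> cball x (sqrt (4 * S * \<bar>ln (\<delta> * (S - T))\<bar>))" and t: "t \<in> {0..T}"
    show "?\<phi> y t = 0"
    proof (rule trunc_eq_0, rule ccontr)
      assume "\<not> gauss (S - t) (y - x) \<le> \<delta>"
      then have "(y - x) \<bullet> (y - x) \<le> 4 * (S - t) * (- ln (\<delta> * (S - T)))"
        using gauss_gt_imp[of \<delta> "S - t" "y - x" "S - T"] assms t by (auto simp: algebra_simps)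
      also have "\<dots> \<le> 4 * (S - t) * \<bar>ln (\<delta> * (S - T))\<bar>"
        using assms t by (intro mult_left_mono) auto
      also have "\<dots> \<le> 4 * S * \<bar>ln (\<delta> * (S - T))\<bar>"
        using assms t by (intro mult_right_mono) auto
      finally show False
        using y by (simp add: dist_norm norm_minus_commute[of x] norm_eq_sqrt_inner[of "y - x"])
    qed
  qed simp
qed

section \<open>Mass and size of the Gaussian\<close>

text \<open>Up to \<open>4 * pi\<close> this is the density of two independent normal variables of
  variance \<open>2 * \<tau>\<close>, which yields a total mass independent of
  \<open>\<tau>\<close>.\<close>

lemma gauss_eq_prod_normal_density:
  fixes x y :: "real^2"
  assumes "0 < \<tau>"
  shows "gauss \<tau> (y - x) = 4 * pi * (\<Prod>b\<in>Basis. normal_density (x \<bullet> b) (sqrt (2 * \<tau>)) (y \<bullet> b))"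
proof -
  have "(\<Prod>b\<in>Basis. normal_density (x \<bullet> b) (sqrt (2 * \<tau>)) (y \<bullet> b)) =
      (\<Prod>b\<in>(Basis::(real^2) set). 1 / sqrt (4 * pi * \<tau>)) *
      (\<Prod>b\<in>(Basis::(real^2) set). exp (- ((y - x) \<bullet> b)\<^sup>2 / (4 * \<tau>)))"
    using assms by (simp add: normal_density_def inner_diff_left prod_dividef power_divide)
  also have "(\<Prod>b\<in>(Basis::(real^2) set). exp (- ((y - x) \<bullet> b)\<^sup>2 / (4 * \<tau>))) =
      exp (- ((y - x) \<bullet> (y - x)) / (4 * \<tau>))"
    by (simp add: exp_sum[symmetric] euclidean_inner[of "y - x" "y - x"] power2_eq_square
        sum_negf sum_divide_distrib)
  also have "(\<Prod>b\<in>(Basis::(real^2) set). 1 / sqrt (4 * pi * \<tau>)) = 1 / (4 * pi * \<tau>)"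
    using assms by (simp add: power_divide power2_eq_square)
  finally show ?thesis
    by (simp add: gauss_def)
qed

lemma gauss_measurable [measurable (raw)]:
  fixes g :: "'b \<Rightarrow> real^2"
  assumes [measurable]: "f \<in> borel_measurable M" "g \<in> borel_measurable M"
  shows "(\<lambda>w. gauss (f w) (g w)) \<in> borel_measurable M"
  unfolding gauss_def by measurable

lemma trunc_measurable [measurable (raw)]:
  assumes [measurable]: "f \<in> borel_measurable M"
  shows "(\<lambda>w. trunc \<delta> (f w)) \<in> borel_measurable M" "(\<lambda>w. trunc'' \<delta> (f w)) \<in> borel_measurable M"
  unfolding trunc_def trunc''_def by measurable

lemma has_bochner_integral_gauss:
  fixes x :: "real^2"
  assumes "0 < \<tau>"
  shows "has_bochner_integral lborel (\<lambda>y. gauss \<tau> (y - x)) (4 * pi)"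
proof (rule has_bochner_integral_nn_integral)
  have "(\<integral>\<^sup>+y. gauss \<tau> (y - x) \<partial>lborel) =
     (\<integral>\<^sup>+y. ennreal (4 * pi) * (\<Prod>b\<in>Basis. ennreal (normal_density (x \<bullet> b) (sqrt (2 * \<tau>)) (y \<bullet> b))) \<partial>lborel)"
    by (intro nn_integral_cong)
      (simp add: gauss_eq_prod_normal_density[OF assms] ennreal_mult' prod_nonneg prod_ennreal)
  also have "\<dots> = ennreal (4 * pi) *
      (\<integral>\<^sup>+y. (\<Prod>b\<in>Basis. ennreal (normal_density (x \<bullet> b) (sqrt (2 * \<tau>)) (y \<bullet> b))) \<partial>lborel)"
    by (intro nn_integral_cmult) measurable
  also have "(\<integral>\<^sup>+y. (\<Prod>b\<in>Basis. ennreal (normal_density (x \<bullet> b) (sqrt (2 * \<tau>)) (y \<bullet> b))) \<partial>lborel) = 1"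
    using assms by (subst nn_integral_lborel_prod) (auto simp: nn_integral_eq_integral)
  finally show "(\<integral>\<^sup>+y. gauss \<tau> (y - x) \<partial>lborel) = ennreal (4 * pi)"
    by simp
qed (use gauss_pos[OF assms] in \<open>auto intro: less_imp_le\<close>)

lemmas integrable_gauss = has_bochner_integral_gauss[THEN integrable.intros]
lemmas integral_gauss = has_bochner_integral_integral_eq[OF has_bochner_integral_gauss]

lemma gauss_le: "0 < \<tau> \<Longrightarrow> gauss \<tau> z \<le> 1 / \<tau>"
  by (simp add: gauss_def divide_right_mono)

text \<open>The lower bound \<open>d\<close> for \<open>\<tau>\<close> makes the exponential factor
  constant in time, so that only the decay \<open>1 / \<tau>\<close> is left to integrate.\<close>

lemma gauss_ge:
  assumes "0 < d" "d \<le> \<tau>" "norm z \<le> r"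
  shows "exp (- r\<^sup>2 / (4 * d)) / \<tau> \<le> gauss \<tau> z"
proof -
  have "(z \<bullet> z) / (4 * \<tau>) \<le> r\<^sup>2 / (4 * d)"
    using assms by (intro frac_le) (auto simp: dot_square_norm power_mono)
  then show ?thesis
    using assms by (simp add: gauss_def divide_right_mono)
qed

text \<open>For \<open>\<tau> \<le> 1\<close> use the total mass \<open>4 * pi\<close> and
  \<open>1 + \<tau> \<le> 2\<close>; for larger \<open>\<tau>\<close> use the maximum
  \<open>1 / \<tau>\<close> times the area of the disc and
  \<open>1 + \<tau> \<le> 2 * \<tau>\<close>. Integrating this decay in time produces the
  logarithm.\<close>

lemma integral_gauss_ball_le:
  fixes x :: "real^2"
  assumes "0 < \<tau>" "0 < L"
  shows "(LINT y|lborel. indicator (ball 0 L) y * gauss \<tau> (y - x)) \<le> (8 * pi + 2 * pi * L\<^sup>2) / (1 + \<tau>)"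
proof -
  have int: "integrable lborel (\<lambda>y. indicator (ball 0 L) y * gauss \<tau> (y - x))"
    using integrable_real_mult_indicator[OF _ integrable_gauss[OF assms(1)], of "ball 0 L" x]
    by (simp add: mult.commute)
  show ?thesis
proof (cases "\<tau> \<le> 1")
  case True
  have "(LINT y|lborel. indicator (ball 0 L) y * gauss \<tau> (y - x)) \<le> (LINT y|lborel. gauss \<tau> (y - x))"
    using gauss_nonneg[OF assms(1)]
    by (intro integral_mono int integrable_gauss assms(1)) (auto simp: indicator_def)
  also have "\<dots> \<le> (8 * pi + 2 * pi * L\<^sup>2) / (1 + \<tau>)"
  proof -
    have "pi * \<tau> \<le> pi * 1" "0 \<le> pi * L\<^sup>2"
      using True by (auto intro: mult_left_mono)
    then have "4 * pi * (1 + \<tau>) \<le> 8 * pi + 2 * pi * L\<^sup>2"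
      unfolding distrib_left by linarith
    then show ?thesis
      using assms by (simp add: integral_gauss pos_le_divide_eq)
  qed
  finally show ?thesis .
next
  case False
  have "(LINT y|lborel. indicator (ball 0 L) y * gauss \<tau> (y - x)) \<le>
      (LINT y|lborel. (1 / \<tau>) * indicator (ball (0::real^2) L) y)"
    using gauss_pos[OF assms(1)] gauss_le[OF assms(1)]
    by (intro integral_mono int integrable_mult_right integrable_real_indicator)
      (auto simp: indicator_def emeasure_lborel_ball_finite[unfolded infinity_ennreal_def])
  also have "\<dots> = pi * L\<^sup>2 / \<tau>"
    using assms by (simp add: content_ball unit_ball_vol_2)
  also have "\<dots> \<le> (2 * pi * L\<^sup>2) / (1 + \<tau>)"
    using False assms by (simp add: field_simps)
  also have "\<dots> \<le> (8 * pi + 2 * pi * L\<^sup>2) / (1 + \<tau>)"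
    using assms by (simp add: divide_right_mono)
  finally show ?thesis .
  qed
qed

text \<open>The truncation level belonging to a pole at time \<open>T + \<epsilon>\<close> is \<open>\<epsilon>\<^sup>3\<close>: the integral of the defect is then of order
  \<open>\<epsilon> (log \<epsilon>)\<^sup>2\<close>, while at time \<open>T\<close> the support still shrinks to the pole as \<open>\<epsilon>\<close> tends to 0.\<close>

lemma gauss_le_cube:
  assumes "0 < \<epsilon>" "\<epsilon> < 1" "\<epsilon> \<le> \<tau>" "-16 * \<tau> * ln \<epsilon> < z \<bullet> z"
  shows "gauss \<tau> z \<le> \<epsilon>^3"
proof (rule ccontr)
  assume "\<not> gauss \<tau> z \<le> \<epsilon>^3"
  then have "z \<bullet> z \<le> - 4 * \<tau> * ln (\<epsilon>^3 * \<epsilon>)"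
    using assms by (intro gauss_gt_imp) auto
  also have "\<epsilon>^3 * \<epsilon> = \<epsilon>^4"
    by (simp add: numeral_eq_Suc)
  finally show False
    using assms by (simp add: ln_realpow)
qed

text \<open>The value of \<open>\<partial>\<^sub>s + \<Delta>\<close> at the test function \<open>trunc \<delta> (gauss (S - s) (y - x))\<close>, expressed in terms of
  \<open>\<tau> = S - s\<close> and \<open>z = y - x\<close>.\<close>

definition defect :: "real \<Rightarrow> real \<Rightarrow> 'a::real_inner \<Rightarrow> real" where
  "defect \<delta> \<tau> z = trunc'' \<delta> (gauss \<tau> z) * (gauss \<tau> z)\<^sup>2 * (z \<bullet> z) / (4 * \<tau>\<^sup>2)"

lemma defect_nonneg: "0 < \<tau> \<Longrightarrow> 0 \<le> defect \<delta> \<tau> z"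
  by (simp add: defect_def trunc''_nonneg gauss_pos)

text \<open>Outside the disc the Gaussian is below the truncation level. Inside,
  \<open>trunc''_le\<close> and the bound on \<open>z \<bullet> z\<close> give the constant 24 = 6 *
  16 / 4, and dividing \<open>\<epsilon>^3\<close> by
  \<open>\<tau>\<^sup>2 \<ge> \<epsilon>\<^sup>2\<close> leaves one power of
  \<open>\<epsilon>\<close>.\<close>

lemma defect_le:
  assumes "0 < \<epsilon>" "\<epsilon> < 1" "\<epsilon> \<le> \<tau>" "\<tau> \<le> S"
  shows "defect (\<epsilon>^3) \<tau> z \<le> - 24 * \<epsilon> * S * ln \<epsilon> * indicator (cball 0 (sqrt (- 16 * S * ln \<epsilon>))) z"
proof (cases "-16 * S * ln \<epsilon> < z \<bullet> z")
  case True
  have "16 * S * ln \<epsilon> \<le> 16 * \<tau> * ln \<epsilon>"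
    using assms by (simp add: mult_right_mono_neg)
  with True have "-16 * \<tau> * ln \<epsilon> < z \<bullet> z"
    by linarith
  then have "gauss \<tau> z \<le> \<epsilon>^3"
    using assms by (intro gauss_le_cube) auto
  then have "defect (\<epsilon>^3) \<tau> z = 0"
    by (simp add: defect_def trunc''_eq_0)
  moreover have "z \<notin> cball 0 (sqrt (- 16 * S * ln \<epsilon>))"
    using True by (simp add: norm_eq_sqrt_inner)
  ultimately show ?thesis
    by simp
next
  case False
  then have z: "z \<in> cball 0 (sqrt (- 16 * S * ln \<epsilon>))"
    by (simp add: norm_eq_sqrt_inner)
  have "trunc'' (\<epsilon>^3) (gauss \<tau> z) * (gauss \<tau> z)\<^sup>2 * (z \<bullet> z) \<le> 6 * \<epsilon>^3 * (-16 * S * ln \<epsilon>)"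
    using assms False by (intro mult_mono trunc''_le) (auto simp: gauss_pos)
  then have "trunc'' (\<epsilon>^3) (gauss \<tau> z) * (gauss \<tau> z)\<^sup>2 * (z \<bullet> z) / (4 * \<tau>\<^sup>2) \<le>
      6 * \<epsilon>^3 * (-16 * S * ln \<epsilon>) / (4 * \<epsilon>\<^sup>2)"
    using assms by (intro frac_le) (auto simp: mult_nonneg_nonpos power_mono)
  also have "\<dots> = - 24 * \<epsilon> * S * ln \<epsilon>"
    using assms by (simp add: power3_eq_cube power2_eq_square)
  finally show ?thesis
    using z by (simp add: defect_def)
qed

lemma integrable_trunc_gauss:
  fixes x :: "real^2"
  assumes "0 < \<epsilon>"
  shows "integrable lborel (\<lambda>y. trunc (\<epsilon>^3) (gauss \<epsilon> (y - x)))"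
  using assms
  by (intro Bochner_Integration.integrable_bound[OF integrable_gauss[of \<epsilon> x]])
    (auto simp: trunc_nonneg trunc_le gauss_nonneg gauss_pos)

text \<open>On the disc of radius \<open>sqrt (4 * \<epsilon>)\<close>, of area
  \<open>4 * pi * \<epsilon>\<close>, the Gaussian is at least \<open>exp (-1) / \<epsilon>\<close>.
  This is at least twice the truncation level, so truncating costs at most a factor 8 there.\<close>

lemma integral_trunc_gauss_ge:
  fixes x :: "real^2"
  assumes "0 < \<epsilon>" "2 * \<epsilon>^4 \<le> exp (-1)"
  shows "pi * exp (-1) / 2 \<le> (LINT y|lborel. trunc (\<epsilon>^3) (gauss \<epsilon> (y - x)))"
proof -
  have "pi * exp (-1) / 2 = (LINT y|lborel. (exp (-1) / \<epsilon> / 8) * indicator (cball x (sqrt (4 * \<epsilon>))) y)"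
    using assms by (simp add: content_cball unit_ball_vol_2)
  also have "\<dots> \<le> (LINT y|lborel. trunc (\<epsilon>^3) (gauss \<epsilon> (y - x)))"
  proof (rule integral_mono)
    show "integrable lborel (\<lambda>y. trunc (\<epsilon>^3) (gauss \<epsilon> (y - x)))"
      by (rule integrable_trunc_gauss[OF assms(1)])
    fix y
    show "(exp (-1) / \<epsilon> / 8) * indicator (cball x (sqrt (4 * \<epsilon>))) y \<le> trunc (\<epsilon>^3) (gauss \<epsilon> (y - x))"
    proof (cases "y \<in> cball x (sqrt (4 * \<epsilon>))")
      case True
      then have g: "exp (-1) / \<epsilon> \<le> gauss \<epsilon> (y - x)"
        using gauss_ge[of \<epsilon> \<epsilon> "y - x" "sqrt (4 * \<epsilon>)"] assms
        by (simp add: dist_norm norm_minus_commute)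
      have "2 * \<epsilon>^3 \<le> exp (-1) / \<epsilon>"
        using assms by (simp add: field_simps numeral_eq_Suc)
      with g have "gauss \<epsilon> (y - x) / 8 \<le> trunc (\<epsilon>^3) (gauss \<epsilon> (y - x))"
        using assms gauss_pos by (intro trunc_ge) auto
      with g True show ?thesis by simp
    qed (use assms in \<open>simp add: trunc_nonneg gauss_pos\<close>)
  qed (use assms in \<open>auto simp: emeasure_cball\<close>)
  finally show ?thesis .
qed

lemma has_bochner_integral_inverse_linear:
  fixes a b S :: real
  assumes "a \<le> b" "b < S"
  shows "has_bochner_integral lborel (\<lambda>s. 1 / (S - s) * indicator {a..b} s) (ln (S - a) - ln (S - b))"
proof -
  have "has_bochner_integral lborel (\<lambda>s. 1 / (S - s) * indicator {a..b} s) (- ln (S - b) - - ln (S - a))"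
    using assms by (intro has_bochner_integral_FTC_Icc_real)
      (auto intro!: derivative_eq_intros continuous_intros)
  then show ?thesis by simp
qed

subsection \<open>Duhamel estimates\<close>

locale weak_solution =
  fixes p L :: real and u\<^sub>0 :: "real^2 \<Rightarrow> real" and u :: "real^2 \<Rightarrow> real \<Rightarrow> real"
  assumes p_pos: "0 < p" and p_less_1: "p < 1" and L_pos: "0 < L"
    and integrable_init: "integrable lborel u\<^sub>0"
    and solution: "bounded_solution p L u\<^sub>0 u"
begin

section \<open>Regularity and boundedness of the solution\<close>

lemma u_nonneg: "0 \<le> t \<Longrightarrow> 0 \<le> u x t"
  using solution by (simp add: bounded_solution_def)

lemma u_init: "u x 0 = u\<^sub>0 x"
  using solution by (simp add: bounded_solution_def)

lemma init_nonneg: "0 \<le> u\<^sub>0 x"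
  using u_nonneg[of 0 x] by (simp add: u_init)

lemma continuous_on_u: "continuous_on (UNIV \<times> {0..}) (\<lambda>w. u (fst w) (snd w))"
  using solution by (simp add: bounded_solution_def case_prod_beta)

lemma continuous_on_u_slice: "0 \<le> t \<Longrightarrow> continuous_on A (\<lambda>x. u x t)"
  by (rule continuous_on_compose2[OF continuous_on_u, of A "\<lambda>x. (x, t)", simplified])
    (auto intro!: continuous_intros)

text \<open>Values at negative times are arbitrary; clamping time at 0 gives a function continuous
  on the whole space, hence jointly measurable.\<close>

lemma measurable_u_clamped: "(\<lambda>w. u (snd w) (max 0 (fst w))) \<in> borel_measurable (lborel \<Otimes>\<^sub>M lborel)"
proof -
  have "continuous_on UNIV (\<lambda>w. u (snd w) (max 0 (fst w)))"
    by (rule continuous_on_compose2[OF continuous_on_u, of UNIV "\<lambda>w. (snd w, max 0 (fst w))", simplified])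
      (auto intro!: continuous_intros)
  then have "(\<lambda>w. u (snd w) (max 0 (fst w))) \<in> borel_measurable borel"
    by (rule borel_measurable_continuous_onI)
  then show ?thesis
    by (simp add: lborel_prod)
qed

lemma measurable_u_slice: "0 \<le> t \<Longrightarrow> (\<lambda>x. u x t) \<in> borel_measurable borel"
  by (intro borel_measurable_continuous_onI continuous_on_u_slice)

lemma bound_u:
  obtains M where "0 \<le> M" "\<And>x s. 0 \<le> s \<Longrightarrow> s \<le> T \<Longrightarrow> u x s \<le> M"
proof -
  \<comment> \<open>The solution is assumed bounded only up to positive times, whereas
    \<open>T\<close> is arbitrary here; hence \<open>max 1 T\<close>.\<close>
  have "bounded ((\<lambda>(x, t). u x t) ` (UNIV \<times> {0..max 1 T}))"
    using solution by (simp add: bounded_solution_def)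
  then obtain M where M: "\<And>v. v \<in> (\<lambda>(x, t). u x t) ` (UNIV \<times> {0..max 1 T}) \<Longrightarrow> norm v \<le> M"
    unfolding bounded_iff by blast
  have "u x s \<le> \<bar>M\<bar>" if "0 \<le> s" "s \<le> T" for x s
  proof -
    have "u x s \<in> (\<lambda>(x, t). u x t) ` (UNIV \<times> {0..max 1 T})"
      using that by (auto intro!: image_eqI[of _ _ "(x, s)"])
    from M[OF this] show ?thesis by auto
  qed
  then show thesis by (intro that[of "\<bar>M\<bar>"]) auto
qed

section \<open>The weak formulation tested with the truncated kernel\<close>

text \<open>The space-time integrand left after the cancellation in
  \<open>trace_trunc_gauss_hessian\<close>: an error term from the truncation and the reaction term
  of Duhamel's formula.\<close>

definition source :: "real \<Rightarrow> real \<Rightarrow> real^2 \<Rightarrow> real \<Rightarrow> real^2 \<Rightarrow> real" where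
  "source \<epsilon> S x s y = u y s * defect (\<epsilon>^3) (S - s) (y - x) +
     indicator (ball 0 L) y * (u y s powr p) * trunc (\<epsilon>^3) (gauss (S - s) (y - x))"

text \<open>The pole lies at \<open>T + \<epsilon>\<close>, so the kernel has parameter
  \<open>\<epsilon>\<close> at the final time and \<open>T + \<epsilon>\<close> at time 0.\<close>

lemma kernel_identity:
  assumes "0 < T" "0 < \<epsilon>"
  shows "(LINT y|lborel. u y T * trunc (\<epsilon>^3) (gauss \<epsilon> (y - x))) =
    (LINT y|lborel. u\<^sub>0 y * trunc (\<epsilon>^3) (gauss (T + \<epsilon>) (y - x))) +
    (LINT s:{0..T}|lborel. LINT y|lborel. source \<epsilon> (T + \<epsilon>) x s y)"
proof -
  have "test_function T (\<lambda>y s. trunc (\<epsilon>^3) (gauss (T + \<epsilon> - s) (y - x)))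
    (\<lambda>y s. - (trunc' (\<epsilon>^3) (gauss (T + \<epsilon> - s) (y - x)) * (gauss (T + \<epsilon> - s) (y - x) *
      (((y - x) \<bullet> (y - x)) / (4 * (T + \<epsilon> - s)\<^sup>2) - 1 / (T + \<epsilon> - s)))))
    (\<lambda>y s. - (trunc' (\<epsilon>^3) (gauss (T + \<epsilon> - s) (y - x)) * gauss (T + \<epsilon> - s) (y - x) / (2 * (T + \<epsilon> - s))) *\<^sub>R (y - x))
    (\<lambda>y s. trunc_gauss_hessian (\<epsilon>^3) (T + \<epsilon> - s) (y - x))"
    using assms by (intro test_function_trunc_gauss) auto
  with solution assms(1) show ?thesis
    unfolding bounded_solution_def source_def
    by (fastforce simp: trace_trunc_gauss_hessian defect_def)
qed

lemma source_nonneg: "s < S \<Longrightarrow> 0 \<le> s \<Longrightarrow> 0 \<le> source \<epsilon> S x s y"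
  by (simp add: source_def u_nonneg defect_nonneg trunc_nonneg gauss_pos)

lemma source_le:
  assumes "0 < \<epsilon>" "\<epsilon> < 1" "0 \<le> s" "s \<le> T" "0 \<le> M" "u y s \<le> M"
  shows "source \<epsilon> (T + \<epsilon>) x s y \<le>
    M * (- 24 * \<epsilon> * (T + \<epsilon>) * ln \<epsilon>) * indicator (cball x (sqrt (- 16 * (T + \<epsilon>) * ln \<epsilon>))) y +
    M powr p * (indicator (ball 0 L) y * gauss (T + \<epsilon> - s) (y - x))"
proof -
  have "u y s * defect (\<epsilon>^3) (T + \<epsilon> - s) (y - x) \<le>
      M * (- 24 * \<epsilon> * (T + \<epsilon>) * ln \<epsilon> * indicator (cball 0 (sqrt (- 16 * (T + \<epsilon>) * ln \<epsilon>))) (y - x))"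
    using assms by (intro mult_mono defect_le) (auto simp: defect_nonneg)
  moreover have "indicator (cball 0 (sqrt (- 16 * (T + \<epsilon>) * ln \<epsilon>))) (y - x) =
      (indicator (cball x (sqrt (- 16 * (T + \<epsilon>) * ln \<epsilon>))) y :: real)"
    by (simp add: indicator_def dist_norm norm_minus_commute)
  moreover have "u y s powr p * trunc (\<epsilon>^3) (gauss (T + \<epsilon> - s) (y - x)) \<le>
      M powr p * gauss (T + \<epsilon> - s) (y - x)"
    using assms p_pos
    by (intro mult_mono powr_mono2 trunc_le) (auto simp: u_nonneg trunc_nonneg gauss_pos)
  then have "indicator (ball 0 L) y * (u y s powr p) * trunc (\<epsilon>^3) (gauss (T + \<epsilon> - s) (y - x)) \<le>
      M powr p * (indicator (ball 0 L) y * gauss (T + \<epsilon> - s) (y - x))"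
    by (simp add: indicator_def)
  ultimately show ?thesis
    by (simp add: source_def mult.assoc)
qed

text \<open>The integrand is bounded and vanishes outside a bounded set, uniformly in
  \<open>s\<close>, so Fubini applies. Integrability must be secured before integrals are compared,
  since a nonintegrable function has integral 0 by convention.\<close>

lemma integrable_source:
  assumes "0 < \<epsilon>" "\<epsilon> < 1" "0 < T"
  shows "set_integrable lborel {0..T} (\<lambda>s. LINT y|lborel. source \<epsilon> (T + \<epsilon>) x s y)"
    and "0 \<le> s \<Longrightarrow> s \<le> T \<Longrightarrow> integrable lborel (source \<epsilon> (T + \<epsilon>) x s)"
proof -
  obtain M where M: "0 \<le> M" "\<And>x s. 0 \<le> s \<Longrightarrow> s \<le> T \<Longrightarrow> u x s \<le> M"
    using bound_u by blast
  define r where "r = sqrt (- 16 * (T + \<epsilon>) * ln \<epsilon>)"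
  define B where "B = M * (- 24 * \<epsilon> * (T + \<epsilon>) * ln \<epsilon>) + M powr p * (1 / \<epsilon>)"
  define A where "A = cball x r \<union> ball 0 L"
  have neg: "(T + \<epsilon>) * ln \<epsilon> \<le> 0"
    using assms by (intro mult_nonneg_nonpos) auto
  have bd: "norm (source \<epsilon> (T + \<epsilon>) x s y) \<le> B" if s: "0 \<le> s" "s \<le> T" for s y
  proof -
    have "gauss (T + \<epsilon> - s) (y - x) \<le> 1 / \<epsilon>"
      using gauss_le[of "T + \<epsilon> - s" "y - x"] s assms
      by (rule_tac order_trans) (auto intro!: frac_le)
    then have "M * (- 24 * \<epsilon> * (T + \<epsilon>) * ln \<epsilon>) * indicator (cball x r) y +
        M powr p * (indicator (ball 0 L) y * gauss (T + \<epsilon> - s) (y - x)) \<le>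
        M * (- 24 * \<epsilon> * (T + \<epsilon>) * ln \<epsilon>) * 1 + M powr p * (1 * (1 / \<epsilon>))"
      using M assms s neg
      by (intro add_mono mult_left_mono mult_mono) (auto simp: gauss_nonneg indicator_def mult_nonneg_nonpos mult.assoc)
    from order_trans[OF source_le[OF assms(1,2) s M(1) M(2)[OF s], of x, folded r_def] this]
    show ?thesis
      using source_nonneg[of s "T + \<epsilon>" \<epsilon> x y] s assms(1) by (simp add: B_def)
  qed
  \<comment> \<open>Off \<open>A\<close> both indicators in the bound of \<open>source_le\<close>
    vanish, which squeezes the nonnegative integrand to 0.\<close>
  have zero: "source \<epsilon> (T + \<epsilon>) x s y = 0" if s: "0 \<le> s" "s \<le> T" and "y \<notin> A" for s y
    using source_le[OF assms(1,2) s M(1) M(2)[OF s], of x y, folded r_def]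
      source_nonneg[of s "T + \<epsilon>" \<epsilon> x y] that assms
    by (simp add: A_def)
  have [measurable]: "ball (0::real^2) L \<in> sets borel"
    by simp
  have A: "A \<in> sets lborel" "emeasure lborel A < \<infinity>"
    unfolding A_def by (simp, intro emeasure_bounded_finite) auto
  show "integrable lborel (source \<epsilon> (T + \<epsilon>) x s)" if s: "0 \<le> s" "s \<le> T"
  proof (rule integrableI_bounded_set[of A _ _ B])
    note [measurable] = measurable_u_slice[OF s(1)]
    show "source \<epsilon> (T + \<epsilon>) x s \<in> borel_measurable lborel"
      unfolding source_def[abs_def] defect_def
      by measurable
  qed (use A bd zero s in auto)
  note [measurable] = measurable_u_clamped
  \<comment> \<open>Written with the clamped solution for joint measurability; the indicator of
    \<open>{0..T}\<close> makes clamping harmless.\<close>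
  define F where "F = (\<lambda>w. indicator {0..T} (fst w) * (u (snd w) (max 0 (fst w)) * defect (\<epsilon>^3) (T + \<epsilon> - fst w) (snd w - x) +
     indicator (ball 0 L) (snd w) * (u (snd w) (max 0 (fst w)) powr p) * trunc (\<epsilon>^3) (gauss (T + \<epsilon> - fst w) (snd w - x))))"
  have F: "F (s, y) = indicator {0..T} s * source \<epsilon> (T + \<epsilon>) x s y" for s y
    by (simp add: F_def source_def indicator_def)
  have "integrable (lborel \<Otimes>\<^sub>M lborel) F"
  proof (rule integrableI_bounded_set[of "{0..T} \<times> A" _ _ B])
    show "F \<in> borel_measurable (lborel \<Otimes>\<^sub>M lborel)"
      unfolding F_def defect_def by measurable
    show "{0..T} \<times> A \<in> sets (lborel \<Otimes>\<^sub>M lborel)"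
      using A by auto
    show "emeasure (lborel \<Otimes>\<^sub>M lborel) ({0..T} \<times> A) < \<infinity>"
      using A assms by (subst lborel.emeasure_pair_measure_Times) (auto simp: ennreal_mult_less_top)
    show "AE w in lborel \<Otimes>\<^sub>M lborel. w \<in> {0..T} \<times> A \<longrightarrow> norm (F w) \<le> B"
      using bd by (intro AE_I2) (auto simp: F)
    show "AE w in lborel \<Otimes>\<^sub>M lborel. w \<notin> {0..T} \<times> A \<longrightarrow> F w = 0"
    proof (rule AE_I2, rule impI)
      fix w :: "real \<times> (real^2)" assume "w \<notin> {0..T} \<times> A"
      then show "F w = 0"
        using zero[of "fst w" "snd w"] F[of "fst w" "snd w"]
        by (auto simp: indicator_def mem_Times_iff)
    qed
  qed
  from lborel_pair.integrable_fst'[OF this]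
  show "set_integrable lborel {0..T} (\<lambda>s. LINT y|lborel. source \<epsilon> (T + \<epsilon>) x s y)"
    by (simp add: set_integrable_def F)
qed

section \<open>Two-sided estimates with the pole still at distance \<open>\<epsilon>\<close>\<close>

text \<open>The three summands bound the initial term (the kernel is at most \<open>1 / T\<close>),
  the defect (height times area of its disc, 24 * 16 = 384) and the reaction, where
  \<open>integral_gauss_ball_le\<close> is integrated over \<open>{0..T}\<close>.\<close>

lemma upper_estimate_kernel:
  assumes "0 < \<epsilon>" "\<epsilon> < 1" "0 < T" and M: "0 \<le> M" "\<And>y s. 0 \<le> s \<Longrightarrow> s \<le> T \<Longrightarrow> u y s \<le> M"
  shows "(LINT y|lborel. u y T * trunc (\<epsilon>^3) (gauss \<epsilon> (y - x))) \<le>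
    (LINT y|lborel. u\<^sub>0 y) / T + T * (384 * pi * M * \<epsilon> * ((T + \<epsilon>) * ln \<epsilon>)\<^sup>2) +
    M powr p * (8 * pi + 2 * pi * L\<^sup>2) * ln (1 + T + \<epsilon>)"
proof -
  let ?C = "8 * pi + 2 * pi * L\<^sup>2"
  let ?E = "384 * pi * M * \<epsilon> * ((T + \<epsilon>) * ln \<epsilon>)\<^sup>2"
  have neg: "(T + \<epsilon>) * ln \<epsilon> \<le> 0"
    using assms by (intro mult_nonneg_nonpos) auto
  have init: "(LINT y|lborel. u\<^sub>0 y * trunc (\<epsilon>^3) (gauss (T + \<epsilon>) (y - x))) \<le> (LINT y|lborel. u\<^sub>0 y * (1 / T))"
  proof (rule integral_mono')
    fix y
    have "gauss (T + \<epsilon>) (y - x) \<le> 1 / T"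
      using gauss_le[of "T + \<epsilon>" "y - x"] assms by (rule_tac order_trans) (auto intro!: frac_le)
    then show "u\<^sub>0 y * trunc (\<epsilon>^3) (gauss (T + \<epsilon>) (y - x)) \<le> u\<^sub>0 y * (1 / T)"
      using assms by (intro mult_left_mono init_nonneg order_trans[OF trunc_le]) (auto simp: gauss_pos)
  qed (use integrable_init assms in \<open>auto simp: init_nonneg\<close>)
  have "(LINT s:{0..T}|lborel. LINT y|lborel. source \<epsilon> (T + \<epsilon>) x s y) \<le>
      (LINT s:{0..T}|lborel. ?E + M powr p * ?C * (1 / (1 + T + \<epsilon> - s)))"
  proof (rule set_integral_mono)
    fix s assume s: "s \<in> {0..T}"
    define r where "r = sqrt (- 16 * (T + \<epsilon>) * ln \<epsilon>)"
    have int: "integrable lborel (\<lambda>y. indicator (ball 0 L) y * gauss (T + \<epsilon> - s) (y - x))"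
      using integrable_real_mult_indicator[OF _ integrable_gauss, of "ball 0 L" "T + \<epsilon> - s" x] s assms
      by (simp add: mult.commute)
    have int': "integrable lborel (indicator (cball x r) :: real^2 \<Rightarrow> real)"
      by (rule integrable_real_indicator) (auto simp: emeasure_lborel_cball_finite[unfolded infinity_ennreal_def])
    have "(LINT y|lborel. source \<epsilon> (T + \<epsilon>) x s y) \<le>
        (LINT y|lborel. M * (- 24 * \<epsilon> * (T + \<epsilon>) * ln \<epsilon>) * indicator (cball x r) y +
          M powr p * (indicator (ball 0 L) y * gauss (T + \<epsilon> - s) (y - x)))"
      using s assms source_le[of \<epsilon> s T M _ x, folded r_def]
      by (intro integral_mono integrable_source Bochner_Integration.integrable_add integrable_mult_right int int') auto
    also have "\<dots> = M * (- 24 * \<epsilon> * (T + \<epsilon>) * ln \<epsilon>) * (LINT y|lborel. indicator (cball x r) y) +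
          M powr p * (LINT y|lborel. indicator (ball 0 L) y * gauss (T + \<epsilon> - s) (y - x))"
      using int int' by (subst Bochner_Integration.integral_add) auto
    also have "(LINT y|lborel. indicator (cball x r) y) = pi * (- 16 * (T + \<epsilon>) * ln \<epsilon>)"
    proof -
      have nn: "0 \<le> - 16 * ((T + \<epsilon>) * ln \<epsilon>)"
        by (rule mult_nonpos_nonpos[OF _ neg]) simp
      have r2: "r\<^sup>2 = - 16 * (T + \<epsilon>) * ln \<epsilon>"
        unfolding r_def mult.assoc by (rule real_sqrt_pow2[OF nn])
      have r: "0 \<le> r"
        unfolding r_def mult.assoc by (rule real_sqrt_ge_zero[OF nn])
      have "(LINT y|lborel. indicator (cball x r) y) = pi * r\<^sup>2"
        using r by (simp add: content_cball unit_ball_vol_2)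
      then show ?thesis
        by (simp only: r2)
    qed
    also have "M * (- 24 * \<epsilon> * (T + \<epsilon>) * ln \<epsilon>) * (pi * (- 16 * (T + \<epsilon>) * ln \<epsilon>)) = ?E"
      by algebra
    also have "(LINT y|lborel. indicator (ball 0 L) y * gauss (T + \<epsilon> - s) (y - x)) \<le> ?C / (1 + (T + \<epsilon> - s))"
      using s assms L_pos by (intro integral_gauss_ball_le) auto
    also have "?C / (1 + (T + \<epsilon> - s)) = ?C * (1 / (1 + T + \<epsilon> - s))"
      by (simp add: add_diff_eq add.assoc)
    finally show "(LINT y|lborel. source \<epsilon> (T + \<epsilon>) x s y) \<le> ?E + M powr p * ?C * (1 / (1 + T + \<epsilon> - s))"
      by (simp add: mult_left_mono mult.assoc)
  next
    show "set_integrable lborel {0..T} (\<lambda>s. LINT y|lborel. source \<epsilon> (T + \<epsilon>) x s y)"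
      using assms by (intro integrable_source)
    show "set_integrable lborel {0..T} (\<lambda>s. ?E + M powr p * ?C * (1 / (1 + T + \<epsilon> - s)))"
      using assms by (intro borel_integrable_atLeastAtMost' continuous_intros) auto
  qed
  also have "(LINT s:{0..T}|lborel. ?E + M powr p * ?C * (1 / (1 + T + \<epsilon> - s))) =
      T * ?E + M powr p * ?C * (ln (1 + T + \<epsilon>) - ln (1 + \<epsilon>))"
  proof -
    have "has_bochner_integral lborel (\<lambda>s. ?E * indicator {0..T} s +
        (M powr p * ?C) * (1 / (1 + T + \<epsilon> - s) * indicator {0..T} s))
        (?E * T + (M powr p * ?C) * (ln (1 + T + \<epsilon> - 0) - ln (1 + T + \<epsilon> - T)))"
      using assms has_bochner_integral_real_indicator[of "{0..T}" lborel]
      by (intro has_bochner_integral_add has_bochner_integral_mult_right has_bochner_integral_inverse_linear) auto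
    from has_bochner_integral_integral_eq[OF this] show ?thesis
      unfolding set_lebesgue_integral_def by (simp add: algebra_simps)
  qed
  also have "\<dots> \<le> T * ?E + M powr p * ?C * ln (1 + T + \<epsilon>)"
    using assms by (intro add_left_mono mult_left_mono) auto
  finally show ?thesis
    using init kernel_identity[OF assms(3,1), of x] by simp
qed

text \<open>The initial term, the defect and the reaction outside \<open>{a..b}\<close> are
  nonnegative and are dropped. For \<open>y\<close> in the disc the distance to \<open>x\<close> is
  at most \<open>R + L\<close>, so the kernel is bounded below by a constant over
  \<open>T + \<epsilon> - s\<close>, whose integral is the difference of logarithms.\<close>

lemma lower_estimate_kernel:
  assumes "0 < \<epsilon>" "\<epsilon> < 1" "0 \<le> a" "a \<le> b" "b < T" "0 \<le> \<beta>"
    and u: "\<And>y s. y \<in> ball 0 L \<Longrightarrow> s \<in> {a..b} \<Longrightarrow> \<beta> \<le> u y s"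
    and x: "norm x \<le> R" and small: "2 * \<epsilon>^3 \<le> exp (- (R + L)\<^sup>2 / (4 * (T - b))) / (T + \<epsilon>)"
  shows "\<beta> powr p * (pi * L\<^sup>2 * exp (- (R + L)\<^sup>2 / (4 * (T - b))) / 8) * (ln (T + \<epsilon> - a) - ln (T + \<epsilon> - b)) \<le>
    (LINT y|lborel. u y T * trunc (\<epsilon>^3) (gauss \<epsilon> (y - x)))"
proof -
  define k where "k = exp (- (R + L)\<^sup>2 / (4 * (T - b)))"
  have "0 \<le> (LINT y|lborel. u\<^sub>0 y * trunc (\<epsilon>^3) (gauss (T + \<epsilon>) (y - x)))"
    using assms by (intro Bochner_Integration.integral_nonneg) (auto simp: init_nonneg trunc_nonneg gauss_pos)
  moreover have hbi: "has_bochner_integral lborel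
      (\<lambda>s. (\<beta> powr p * (pi * L\<^sup>2 * k / 8)) * (1 / (T + \<epsilon> - s) * indicator {a..b} s))
      (\<beta> powr p * (pi * L\<^sup>2 * k / 8) * (ln (T + \<epsilon> - a) - ln (T + \<epsilon> - b)))"
    using assms by (intro has_bochner_integral_mult_right has_bochner_integral_inverse_linear) auto
  have "(LINT s|lborel. (\<beta> powr p * (pi * L\<^sup>2 * k / 8)) * (1 / (T + \<epsilon> - s) * indicator {a..b} s)) \<le>
      (LINT s:{0..T}|lborel. LINT y|lborel. source \<epsilon> (T + \<epsilon>) x s y)"
    unfolding set_lebesgue_integral_def
  proof (rule integral_mono[OF integrable.intros[OF hbi] integrable_source(1)[unfolded set_integrable_def]])
    fix s
    have nonneg: "0 \<le> (LINT y|lborel. source \<epsilon> (T + \<epsilon>) x s y)" if "s \<in> {0..T}"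
      using that assms by (intro Bochner_Integration.integral_nonneg source_nonneg) auto
    show "(\<beta> powr p * (pi * L\<^sup>2 * k / 8)) * (1 / (T + \<epsilon> - s) * indicator {a..b} s) \<le>
        indicator {0..T} s *\<^sub>R (LINT y|lborel. source \<epsilon> (T + \<epsilon>) x s y)"
    proof (cases "s \<in> {a..b}")
      case True
      have "\<beta> powr p * (pi * L\<^sup>2 * k / 8) * (1 / (T + \<epsilon> - s)) =
          (LINT y|lborel. (\<beta> powr p * (k / (T + \<epsilon> - s) / 8)) * indicator (ball (0::real^2) L) y)"
        using L_pos by (simp add: content_ball unit_ball_vol_2 algebra_simps power2_eq_square)
      also have "\<dots> \<le> (LINT y|lborel. source \<epsilon> (T + \<epsilon>) x s y)"
      proof (intro integral_mono integrable_mult_right integrable_real_indicator integrable_source)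
        fix y
        show "(\<beta> powr p * (k / (T + \<epsilon> - s) / 8)) * indicator (ball 0 L) y \<le> source \<epsilon> (T + \<epsilon>) x s y"
        proof (cases "y \<in> ball 0 L")
          case y: True
          then have "norm (y - x) \<le> R + L"
            using x norm_triangle_ineq4[of y x] by auto
          then have g: "k / (T + \<epsilon> - s) \<le> gauss (T + \<epsilon> - s) (y - x)"
            unfolding k_def using True assms by (intro gauss_ge) auto
          \<comment> \<open>The hypothesis \<open>small\<close> concerns the largest time distance
            \<open>T + \<epsilon>\<close>; this carries it to every \<open>s\<close>, so that
            \<open>trunc_ge\<close> applies.\<close>
          have "k / (T + \<epsilon>) \<le> k / (T + \<epsilon> - s)"
            using True assms by (intro divide_left_mono) (auto simp: k_def)
          with g small have "gauss (T + \<epsilon> - s) (y - x) / 8 \<le> trunc (\<epsilon>^3) (gauss (T + \<epsilon> - s) (y - x))"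
            using True assms by (intro trunc_ge gauss_pos) (auto simp: k_def)
          with divide_right_mono[OF g, of 8]
          have "k / (T + \<epsilon> - s) / 8 \<le> trunc (\<epsilon>^3) (gauss (T + \<epsilon> - s) (y - x))"
            by (rule order_trans[where y = "gauss (T + \<epsilon> - s) (y - x) / 8"]) simp_all
          then have "\<beta> powr p * (k / (T + \<epsilon> - s) / 8) \<le> u y s powr p * trunc (\<epsilon>^3) (gauss (T + \<epsilon> - s) (y - x))"
            using u[OF y True] assms True p_pos by (intro mult_mono powr_mono2) (auto simp: k_def)
          moreover have "0 \<le> u y s * defect (\<epsilon>^3) (T + \<epsilon> - s) (y - x)"
            using True assms by (simp add: u_nonneg defect_nonneg)
          ultimately show ?thesis
            using y by (simp add: source_def)
        qed (use True assms in \<open>auto intro!: source_nonneg\<close>)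
      qed (use True assms in \<open>auto simp: emeasure_lborel_ball_finite[unfolded infinity_ennreal_def]\<close>)
      finally show ?thesis
        using True assms by simp
    qed (use nonneg in \<open>auto simp: indicator_def\<close>)
  qed (use assms in auto)
  ultimately show ?thesis
    using has_bochner_integral_integral_eq[OF hbi] kernel_identity[of T \<epsilon> x] assms by (simp add: k_def)
qed

section \<open>Letting the pole tend to the final time\<close>

text \<open>By \<open>gauss_le_cube\<close> with \<open>\<tau> = \<epsilon>\<close>, the squared
  radius of the support is at most \<open>- 16 * \<epsilon> * ln \<epsilon>\<close>, which tends to
  0; continuity at \<open>x\<close> does the rest.\<close>

lemma eventually_close_on_support:
  assumes "0 < T" "0 < \<eta>"
  shows "\<forall>\<^sub>F \<epsilon> in at_right 0. \<forall>y. \<epsilon>^3 < gauss \<epsilon> (y - x) \<longrightarrow> \<bar>u y T - u x T\<bar> < \<eta>"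
proof -
  have "continuous_on UNIV (\<lambda>y. u y T)"
    using assms by (intro continuous_on_u_slice) auto
  then have "\<exists>d>0. \<forall>y. dist y x < d \<longrightarrow> dist (u y T) (u x T) < \<eta>"
    using assms by (auto simp: continuous_on_iff)
  then obtain d where d: "0 < d" "\<And>y. dist y x < d \<Longrightarrow> dist (u y T) (u x T) < \<eta>"
    by blast
  have "((\<lambda>\<epsilon>. - 16 * \<epsilon> * ln \<epsilon>) \<longlongrightarrow> 0) (at_right (0::real))"
    by real_asymp
  then have "\<forall>\<^sub>F \<epsilon> in at_right 0. - 16 * \<epsilon> * ln \<epsilon> < d\<^sup>2"
    using d by (intro order_tendstoD) auto
  moreover have "\<forall>\<^sub>F \<epsilon> in at_right (0::real). \<epsilon> \<in> {0<..<1}"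
    by (rule eventually_at_right_real) simp
  ultimately show ?thesis
  proof eventually_elim
    case (elim \<epsilon>)
    show ?case
    proof (intro allI impI)
      fix y assume y: "\<epsilon>^3 < gauss \<epsilon> (y - x)"
      have "(y - x) \<bullet> (y - x) \<le> - 16 * \<epsilon> * ln \<epsilon>"
        using gauss_le_cube[of \<epsilon> \<epsilon> "y - x"] y elim by force
      with elim have "(norm (y - x))\<^sup>2 < d\<^sup>2"
        by (simp add: dot_square_norm)
      then have "dist y x < d"
        using d by (auto simp: dist_norm intro: power2_less_imp_less)
      from d(2)[OF this] show "\<bar>u y T - u x T\<bar> < \<eta>"
        by (simp add: dist_real_def)
    qed
  qed
qed

lemma integrable_u_trunc_gauss:
  assumes "0 < \<epsilon>" "0 < T"
  shows "integrable lborel (\<lambda>y. u y T * trunc (\<epsilon>^3) (gauss \<epsilon> (y - x)))"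
proof -
  obtain M where M: "0 \<le> M" "\<And>x s. 0 \<le> s \<Longrightarrow> s \<le> T \<Longrightarrow> u x s \<le> M"
    using bound_u by blast
  have [measurable]: "(\<lambda>y. u y T) \<in> borel_measurable borel"
    using assms by (intro measurable_u_slice) simp
  show ?thesis
    using assms M
    by (intro Bochner_Integration.integrable_bound[OF integrable_mult_right[OF integrable_trunc_gauss[of \<epsilon> x], of M]])
      (auto simp: abs_mult trunc_nonneg gauss_pos u_nonneg intro!: mult_right_mono)
qed

lemma eventually_integral_ge:
  assumes "0 < T" "0 < \<eta>"
  shows "\<forall>\<^sub>F \<epsilon> in at_right 0.
    (u x T - \<eta>) * (pi * exp (-1) / 2) \<le> (LINT y|lborel. u y T * trunc (\<epsilon>^3) (gauss \<epsilon> (y - x)))"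
proof -
  have "\<forall>\<^sub>F \<epsilon> in at_right (0::real). 2 * \<epsilon>^4 \<le> exp (-1)"
    by real_asymp
  with eventually_close_on_support[OF assms, of x] eventually_at_right_less[of "0::real"]
  show ?thesis
  proof eventually_elim
    case (elim \<epsilon>)
    have nonneg: "0 \<le> u y T * trunc (\<epsilon>^3) (gauss \<epsilon> (y - x))" for y
      using elim assms by (simp add: u_nonneg trunc_nonneg gauss_pos)
    show ?case
    \<comment> \<open>The lower bound on the mass may only be multiplied by a nonnegative factor;
      otherwise the left side is nonpositive and the claim is trivial.\<close>
    proof (cases "\<eta> \<le> u x T")
      case True
      then have "(u x T - \<eta>) * (pi * exp (-1) / 2) \<le>
          (u x T - \<eta>) * (LINT y|lborel. trunc (\<epsilon>^3) (gauss \<epsilon> (y - x)))"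
        using elim by (intro mult_left_mono integral_trunc_gauss_ge) auto
      also have "\<dots> = (LINT y|lborel. (u x T - \<eta>) * trunc (\<epsilon>^3) (gauss \<epsilon> (y - x)))"
        by simp
      also have "\<dots> \<le> (LINT y|lborel. u y T * trunc (\<epsilon>^3) (gauss \<epsilon> (y - x)))"
      proof (intro integral_mono integrable_mult_right integrable_trunc_gauss integrable_u_trunc_gauss)
        fix y
        show "(u x T - \<eta>) * trunc (\<epsilon>^3) (gauss \<epsilon> (y - x)) \<le> u y T * trunc (\<epsilon>^3) (gauss \<epsilon> (y - x))"
        proof (cases "\<epsilon>^3 < gauss \<epsilon> (y - x)")
          case True
          with elim have "\<bar>u y T - u x T\<bar> < \<eta>" by blast
          then show ?thesis
            using elim by (intro mult_right_mono) (auto simp: trunc_nonneg gauss_pos)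
        qed (simp add: trunc_eq_0)
      qed (use elim assms in auto)
      finally show ?thesis .
    next
      case False
      then have "(u x T - \<eta>) * (pi * exp (-1) / 2) \<le> 0"
        by (intro mult_nonpos_nonneg) auto
      also have "0 \<le> (LINT y|lborel. u y T * trunc (\<epsilon>^3) (gauss \<epsilon> (y - x)))"
        by (intro Bochner_Integration.integral_nonneg nonneg)
      finally show ?thesis .
    qed
  qed
qed

lemma eventually_integral_le:
  assumes "0 < T" "0 < \<eta>"
  shows "\<forall>\<^sub>F \<epsilon> in at_right 0.
    (LINT y|lborel. u y T * trunc (\<epsilon>^3) (gauss \<epsilon> (y - x))) \<le> (u x T + \<eta>) * (4 * pi)"
  using eventually_close_on_support[OF assms, of x] eventually_at_right_less[of "0::real"]
proof eventually_elim
  case (elim \<epsilon>)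
  have "(LINT y|lborel. u y T * trunc (\<epsilon>^3) (gauss \<epsilon> (y - x))) \<le>
      (LINT y|lborel. (u x T + \<eta>) * gauss \<epsilon> (y - x))"
  proof (intro integral_mono integrable_mult_right integrable_gauss integrable_u_trunc_gauss)
    fix y
    show "u y T * trunc (\<epsilon>^3) (gauss \<epsilon> (y - x)) \<le> (u x T + \<eta>) * gauss \<epsilon> (y - x)"
    proof (cases "\<epsilon>^3 < gauss \<epsilon> (y - x)")
      case True
      with elim have "\<bar>u y T - u x T\<bar> < \<eta>" by blast
      then show ?thesis
        using elim assms u_nonneg[of T x]
        by (intro mult_mono trunc_le) (auto simp: trunc_nonneg gauss_pos)
    qed (use elim assms u_nonneg[of T x] in \<open>simp add: trunc_eq_0 gauss_nonneg\<close>)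
  qed (use elim assms in auto)
  also have "\<dots> = (u x T + \<eta>) * (4 * pi)"
    using elim by (simp add: integral_gauss)
  finally show ?case .
qed

text \<open>Limit of \<open>upper_estimate_kernel\<close>: the defect term carries
  \<open>\<epsilon> * (ln \<epsilon>)\<^sup>2\<close> and vanishes.\<close>

lemma upper_estimate:
  assumes "0 < T" and M: "0 \<le> M" "\<And>y s. 0 \<le> s \<Longrightarrow> s \<le> T \<Longrightarrow> u y s \<le> M"
  shows "u x T * (pi * exp (-1) / 2) \<le>
    (LINT y|lborel. u\<^sub>0 y) / T + M powr p * (8 * pi + 2 * pi * L\<^sup>2) * ln (1 + T)"
    (is "_ \<le> ?A")
proof (rule field_le_epsilon)
  fix e :: real assume "0 < e"
  \<comment> \<open>Chosen so that replacing \<open>u x T\<close> by \<open>u x T - \<eta>\<close>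
    costs exactly \<open>e\<close>.\<close>
  define \<eta> where "\<eta> = e / (pi * exp (-1) / 2)"
  have \<eta>: "0 < \<eta>"
    using \<open>0 < e\<close> by (simp add: \<eta>_def)
  have "((\<lambda>\<epsilon>. \<epsilon> * ((T + \<epsilon>) * ln \<epsilon>)\<^sup>2) \<longlongrightarrow> 0) (at_right 0)"
    using assms(1) by real_asymp
  from tendsto_mult[OF tendsto_const[of "T * (384 * pi * M)"] this]
  have "((\<lambda>\<epsilon>. T * (384 * pi * M * \<epsilon> * ((T + \<epsilon>) * ln \<epsilon>)\<^sup>2)) \<longlongrightarrow> 0) (at_right 0)"
    by (simp add: mult_ac)
  then have "((\<lambda>\<epsilon>. (LINT y|lborel. u\<^sub>0 y) / T + T * (384 * pi * M * \<epsilon> * ((T + \<epsilon>) * ln \<epsilon>)\<^sup>2) +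
      M powr p * (8 * pi + 2 * pi * L\<^sup>2) * ln (1 + T + \<epsilon>)) \<longlongrightarrow>
      (LINT y|lborel. u\<^sub>0 y) / T + 0 + M powr p * (8 * pi + 2 * pi * L\<^sup>2) * ln (1 + T + 0)) (at_right 0)"
    using assms(1) by (intro tendsto_intros) auto
  moreover have "\<forall>\<^sub>F \<epsilon> in at_right (0::real). \<epsilon> \<in> {0<..<1}"
    by (rule eventually_at_right_real) simp
  with eventually_integral_ge[OF assms(1) \<eta>, of x]
  have "\<forall>\<^sub>F \<epsilon> in at_right 0. (u x T - \<eta>) * (pi * exp (-1) / 2) \<le>
      (LINT y|lborel. u\<^sub>0 y) / T + T * (384 * pi * M * \<epsilon> * ((T + \<epsilon>) * ln \<epsilon>)\<^sup>2) +
      M powr p * (8 * pi + 2 * pi * L\<^sup>2) * ln (1 + T + \<epsilon>)"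
    by eventually_elim (rule order_trans, assumption, rule upper_estimate_kernel, use assms in auto)
  ultimately have "(u x T - \<eta>) * (pi * exp (-1) / 2) \<le>
      (LINT y|lborel. u\<^sub>0 y) / T + 0 + M powr p * (8 * pi + 2 * pi * L\<^sup>2) * ln (1 + T + 0)"
    by (rule tendsto_lowerbound) simp
  then show "u x T * (pi * exp (-1) / 2) \<le> ?A + e"
    by (simp add: \<eta>_def left_diff_distrib)
qed

lemma lower_estimate:
  assumes "0 \<le> a" "a \<le> b" "b < T" "0 \<le> \<beta>"
    and u: "\<And>y s. y \<in> ball 0 L \<Longrightarrow> s \<in> {a..b} \<Longrightarrow> \<beta> \<le> u y s"
    and x: "norm x \<le> R"
  shows "\<beta> powr p * (pi * L\<^sup>2 * exp (- (R + L)\<^sup>2 / (4 * (T - b))) / 8) * (ln (T - a) - ln (T - b)) \<le>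
    u x T * (4 * pi)"
proof (rule field_le_epsilon)
  fix e :: real assume "0 < e"
  define \<eta> where "\<eta> = e / (4 * pi)"
  have \<eta>: "0 < \<eta>"
    using \<open>0 < e\<close> by (simp add: \<eta>_def)
  define k where "k = exp (- (R + L)\<^sup>2 / (4 * (T - b)))"
  have T: "0 < T" using assms by simp
  have "((\<lambda>\<epsilon>. \<beta> powr p * (pi * L\<^sup>2 * k / 8) * (ln (T + \<epsilon> - a) - ln (T + \<epsilon> - b))) \<longlongrightarrow>
      \<beta> powr p * (pi * L\<^sup>2 * k / 8) * (ln (T + 0 - a) - ln (T + 0 - b))) (at_right 0)"
    using assms by (intro tendsto_intros) auto
  moreover have "\<forall>\<^sub>F \<epsilon> in at_right 0. \<beta> powr p * (pi * L\<^sup>2 * k / 8) * (ln (T + \<epsilon> - a) - ln (T + \<epsilon> - b)) \<le>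
      (u x T + \<eta>) * (4 * pi)"
  proof -
    \<comment> \<open>The smallness condition holds eventually: its left side tends to 0, its right
      side to \<open>k / T > 0\<close>.\<close>
    have "0 < k" by (simp add: k_def)
    then have "\<forall>\<^sub>F \<epsilon> in at_right 0. 2 * \<epsilon>^3 \<le> k / (T + \<epsilon>)"
      using T by real_asymp
    moreover have "\<forall>\<^sub>F \<epsilon> in at_right (0::real). \<epsilon> \<in> {0<..<1}"
      by (rule eventually_at_right_real) simp
    ultimately show ?thesis
      using eventually_integral_le[OF T \<eta>, of x]
    proof eventually_elim
      case (elim \<epsilon>)
      have "\<beta> powr p * (pi * L\<^sup>2 * k / 8) * (ln (T + \<epsilon> - a) - ln (T + \<epsilon> - b)) \<le>
          (LINT y|lborel. u y T * trunc (\<epsilon>^3) (gauss \<epsilon> (y - x)))"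
        unfolding k_def using elim assms by (intro lower_estimate_kernel) (auto simp: k_def)
      from order_trans[OF this elim(3)] show ?case .
    qed
  qed
  ultimately have "\<beta> powr p * (pi * L\<^sup>2 * k / 8) * (ln (T + 0 - a) - ln (T + 0 - b)) \<le> (u x T + \<eta>) * (4 * pi)"
    by (rule tendsto_upperbound) simp
  then show "\<beta> powr p * (pi * L\<^sup>2 * exp (- (R + L)\<^sup>2 / (4 * (T - b))) / 8) * (ln (T - a) - ln (T - b)) \<le>
      u x T * (4 * pi) + e"
    by (simp add: \<eta>_def k_def distrib_right)
qed

subsection \<open>Logarithmic growth\<close>

lemma upper_bound:
  obtains C where "0 < C" "\<And>x t. 2 \<le> t \<Longrightarrow> u x t \<le> C * ln t powr (1 / (1 - p))"
proof -
  define c where "c = pi * exp (-1) / 2"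
  define C0 where "C0 = 8 * pi + 2 * pi * L\<^sup>2"
  define A where "A = (LINT y|lborel. u\<^sub>0 y)"
  obtain B where B: "0 \<le> B" "\<And>x s. 0 \<le> s \<Longrightarrow> s \<le> 1 \<Longrightarrow> u x s \<le> B"
    using bound_u by blast
  \<comment> \<open>The fraction collects all constants relative to \<open>M powr p * l\<close>; the
    summand 1 ensures \<open>1 \<le> D\<close>, which settles the case
    \<open>M \<le> 1\<close>.\<close>
  define D where "D = (A + c * B + C0) / c + 1"
  have c: "0 < c" and C0: "0 \<le> C0" and A: "0 \<le> A"
    by (auto simp: c_def C0_def A_def init_nonneg)
  have D: "1 \<le> D"
    using c C0 A B by (simp add: D_def)
  have bound: "u x t \<le> (2 * D) powr (1 / (1 - p)) * ln t powr (1 / (1 - p))" if t: "2 \<le> t" for x t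
  proof -
    define S where "S = (\<lambda>(y, s). u y s) ` (UNIV \<times> {0..t})"
    define M where "M = Sup S"
    define l where "l = ln (1 + t)"
    obtain M' where M': "\<And>x s. 0 \<le> s \<Longrightarrow> s \<le> t \<Longrightarrow> u x s \<le> M'"
      using bound_u by blast
    then have "bdd_above S"
      by (auto simp: S_def intro!: bdd_aboveI[of _ M'])
    then have uM: "u y s \<le> M" if "0 \<le> s" "s \<le> t" for y s
      unfolding M_def using that by (intro cSup_upper) (auto simp: S_def intro!: image_eqI[of _ _ "(y, s)"])
    have M: "0 \<le> M"
      using uM[of t 0] u_nonneg[of t 0] t by auto
    have l: "1 \<le> l"
      using t exp_le by (simp add: l_def ln_ge_iff)
    have each: "c * u y s \<le> A + c * B + C0 * M powr p * l" if s: "0 \<le> s" "s \<le> t" for y s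
    \<comment> \<open>The term \<open>A / s\<close> is useless near time 0, where the a priori bound
      \<open>B\<close> takes over.\<close>
    proof (cases "s \<le> 1")
      case True
      then have "c * u y s \<le> c * B"
        using B s c by simp
      also have "\<dots> \<le> A + c * B + C0 * M powr p * l"
        using A C0 l by simp
      finally show ?thesis .
    next
      case False
      then have "u y s * c \<le> A / s + M powr p * C0 * ln (1 + s)"
        unfolding A_def C0_def c_def using M uM s by (intro upper_estimate) auto
      also have "\<dots> \<le> A + M powr p * C0 * l"
        using A C0 False s unfolding l_def
        by (intro add_mono mult_left_mono) (auto simp: divide_le_eq mult_le_cancel_left1)
      also have "\<dots> \<le> A + c * B + C0 * M powr p * l"
        using c B by (simp add: mult_ac)
      finally show ?thesis by (simp add: mult_ac)
    qed
    have "M \<le> (A + c * B + C0 * M powr p * l) / c"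
      unfolding M_def
    proof (rule cSup_least)
      show "S \<noteq> {}" using t by (auto simp: S_def)
      fix v assume "v \<in> S"
      then obtain y s where "v = u y s" "0 \<le> s" "s \<le> t"
        by (auto simp: S_def)
      with each[of s y] c show "v \<le> (A + c * B + C0 * Sup S powr p * l) / c"
        by (simp add: pos_le_divide_eq mult.commute[of "u y s" c] flip: M_def)
    qed
    then have cM: "c * M \<le> A + c * B + C0 * M powr p * l"
      using c by (simp add: pos_le_divide_eq mult_ac)
    have "M \<le> (D * l) powr (1 / (1 - p))"
    proof (cases "M \<le> 1")
      case True
      have "1 * 1 \<le> D * l"
        using D l by (intro mult_mono) auto
      then have "1 \<le> (D * l) powr (1 / (1 - p))"
        using p_less_1 by (intro ge_one_powr_ge_zero) auto
      with True show ?thesis by simp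
    next
      case False
      have Mp: "1 \<le> M powr p"
        using False p_pos by (intro ge_one_powr_ge_zero) auto
      \<comment> \<open>Since this product is at least 1, the additive constants can be absorbed
        into it.\<close>
      have "1 * 1 \<le> M powr p * l"
        using Mp l by (intro mult_mono) auto
      then have "(A + c * B) * 1 \<le> (A + c * B) * (M powr p * l)"
        using A B c by (intro mult_left_mono) auto
      with cM have "c * M \<le> (A + c * B + C0) * (M powr p * l)"
        by (simp add: algebra_simps)
      then have "M \<le> (A + c * B + C0) / c * (M powr p * l)"
        using c by (simp add: field_simps)
      also have "\<dots> \<le> D * (M powr p * l)"
        unfolding D_def using Mp l by (intro mult_right_mono) auto
      \<comment> \<open>Splitting \<open>M\<close> as \<open>M powr p * M powr (1 - p)\<close> and
        cancelling solves the inequality for \<open>M\<close>, because \<open>p < 1\<close>.\<close>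
      finally have "M powr p * M powr (1 - p) \<le> M powr p * (D * l)"
        using False by (simp add: mult_ac flip: powr_add)
      then have "M powr (1 - p) \<le> D * l"
        using Mp by (subst (asm) mult_le_cancel_left_pos) auto
      then have "(M powr (1 - p)) powr (1 / (1 - p)) \<le> (D * l) powr (1 / (1 - p))"
        using p_less_1 by (intro powr_mono2) auto
      then show ?thesis
        using False p_less_1 by (simp add: powr_powr)
    qed
    also have "\<dots> \<le> (2 * D * ln t) powr (1 / (1 - p))"
    proof (rule powr_mono2)
      have "1 + t \<le> t * t"
        using t mult_right_mono[of 2 t t] by linarith
      then have "l \<le> ln (t * t)"
        unfolding l_def using t by (subst ln_le_cancel_iff) auto
      also have "\<dots> = 2 * ln t"
        using t by (simp add: ln_mult)
      finally show "D * l \<le> 2 * D * ln t"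
        using D by simp
    qed (use p_less_1 D l in auto)
    also have "\<dots> = (2 * D) powr (1 / (1 - p)) * ln t powr (1 / (1 - p))"
      using D t by (simp add: powr_mult)
    finally show ?thesis
      using uM[of t x] t by auto
  qed
  show thesis
    using D bound by (intro that[of "(2 * D) powr (1 / (1 - p))"]) auto
qed

section \<open>Lower bound: positivity and induction in time\<close>

text \<open>The datum has a positive minimum on the closed disc, and uniform continuity preserves
  half of it for a short time.\<close>

lemma initially_bounded_below:
  assumes "\<And>x. x \<in> cball 0 L \<Longrightarrow> 0 < u\<^sub>0 x"
  obtains b \<beta> where "0 < b" "b \<le> 1" "0 < \<beta>" "\<And>y s. y \<in> cball 0 L \<Longrightarrow> s \<in> {0..b} \<Longrightarrow> \<beta> \<le> u y s"
proof -
  have "continuous_on (cball 0 L) (\<lambda>y. u y 0)"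
    by (intro continuous_on_u_slice) simp
  then obtain z where z: "z \<in> cball 0 L" "\<And>y. y \<in> cball 0 L \<Longrightarrow> u z 0 \<le> u y 0"
    using continuous_attains_inf[of "cball 0 L" "\<lambda>y. u y 0"] L_pos by auto
  then have pos: "0 < u z 0"
    using assms by (simp add: u_init)
  have "continuous_on (cball 0 L \<times> {0..1}) (\<lambda>w. u (fst w) (snd w))"
    by (rule continuous_on_subset[OF continuous_on_u]) auto
  then have "uniformly_continuous_on (cball 0 L \<times> {0..1}) (\<lambda>w. u (fst w) (snd w))"
    by (intro compact_uniformly_continuous compact_Times) auto
  then obtain d where d: "0 < d" "\<And>w w'. w \<in> cball 0 L \<times> {0..1} \<Longrightarrow> w' \<in> cball 0 L \<times> {0..1} \<Longrightarrow>
      dist w' w < d \<Longrightarrow> dist (u (fst w') (snd w')) (u (fst w) (snd w)) < u z 0 / 2"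
    unfolding uniformly_continuous_on_def using half_gt_zero[OF pos] by meson
  show thesis
  proof (rule that[of "min 1 (d / 2)" "u z 0 / 2"])
    fix y :: "real^2" and s :: real
    assume y: "y \<in> cball 0 L" and s: "s \<in> {0..min 1 (d / 2)}"
    have "dist (u y s) (u y 0) < u z 0 / 2"
      using d(2)[of "(y, 0)" "(y, s)"] y s d(1) by (auto simp: dist_Pair_Pair)
    with z(2)[OF y] show "u z 0 / 2 \<le> u y s"
      unfolding dist_real_def by linarith
  qed (use d pos in auto)
qed

lemma lower_bound:
  assumes "\<And>x. x \<in> cball 0 L \<Longrightarrow> 0 < u\<^sub>0 x" and R: "L \<le> R"
  obtains a where "0 < a" "\<And>x t. 2 \<le> t \<Longrightarrow> norm x \<le> R \<Longrightarrow> a * ln t powr (1 / (1 - p)) \<le> u x t"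
proof -
  obtain b \<beta> where b: "0 < b" "b \<le> 1" "0 < \<beta>" "\<And>y s. y \<in> cball 0 L \<Longrightarrow> s \<in> {0..b} \<Longrightarrow> \<beta> \<le> u y s"
    using initially_bounded_below[OF assms(1)] by blast
  \<comment> \<open>The reaction during \<open>{0..b}\<close> alone already makes the solution
    positive at all later times considered.\<close>
  have pos: "0 < u x t" if "2 \<le> t" "norm x \<le> R" for x t
  proof -
    have "0 < \<beta> powr p * (pi * L\<^sup>2 * exp (- (R + L)\<^sup>2 / (4 * (t - b))) / 8) * (ln (t - 0) - ln (t - b))"
      using b L_pos that by simp
    also have "\<dots> \<le> u x t * (4 * pi)"
      using b that by (intro lower_estimate) auto
    finally show ?thesis by (simp add: zero_less_mult_iff)
  qed
  have cont: "continuous_on (cball 0 R \<times> {2..4}) (\<lambda>w. u (fst w) (snd w))"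
    by (rule continuous_on_subset[OF continuous_on_u]) auto
  have compact: "compact (cball (0::real^2) R \<times> {2..4::real})"
    by (intro compact_Times) auto
  have "(0, 2) \<in> cball (0::real^2) R \<times> {2..4::real}"
    using R L_pos by auto
  with continuous_attains_inf[OF compact _ cont]
  obtain w where w: "w \<in> cball 0 R \<times> {2..4}"
      "\<And>w'. w' \<in> cball 0 R \<times> {2..4} \<Longrightarrow> u (fst w) (snd w) \<le> u (fst w') (snd w')"
    by blast
  define q where "q = 1 / (1 - p)"
  \<comment> \<open>The constant of \<open>lower_estimate\<close> for \<open>T - b = 1\<close>,
    divided by \<open>4 * pi\<close>.\<close>
  define c where "c = L\<^sup>2 * exp (- (R + L)\<^sup>2 / 4) / 32"
  \<comment> \<open>The first entry gives the bound on \<open>{2..4}\<close>. The second means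
    \<open>a powr (1 - p) \<le> c * (1/2) powr q\<close>, so that one induction step reproduces the
    same \<open>a\<close>.\<close>
  define a where "a = min (u (fst w) (snd w) / ln 4 powr q) ((c * (1/2) powr q) powr q)"
  have q: "0 < q" "q * (1 - p) = 1"
    using p_less_1 by (auto simp: q_def)
  then have q': "q * p + 1 = q"
    unfolding right_diff_distrib by linarith
  have c: "0 < c" using L_pos by (simp add: c_def)
  have a: "0 < a" using pos w(1) c by (auto simp: a_def)
  have a_le: "a \<le> a powr p * (c * (1/2) powr q)"
  proof -
    have "a powr (1 - p) \<le> ((c * (1/2) powr q) powr q) powr (1 - p)"
      using a p_less_1 by (intro powr_mono2) (auto simp: a_def)
    also have "\<dots> = c * (1/2) powr q"
      using q c by (simp add: powr_powr)
    finally have "a powr p * a powr (1 - p) \<le> a powr p * (c * (1/2) powr q)"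
      by (intro mult_left_mono) auto
    then show ?thesis
      using a by (simp flip: powr_add)
  qed
  \<comment> \<open>Starting with \<open>{2..4}\<close> ensures that for \<open>t > 4\<close> the
    window \<open>{t / 2..t - 1}\<close> is nonempty and starts above 2; ending it at
    \<open>t - 1\<close> places it within the range of the induction hypothesis.\<close>
  have bound: "\<forall>x t. 2 \<le> t \<longrightarrow> t \<le> 4 + real n \<longrightarrow> norm x \<le> R \<longrightarrow> a * ln t powr q \<le> u x t" for n
  proof (induction n)
    case 0
    show ?case
    proof (intro allI impI)
      fix x :: "real^2" and t :: real assume t: "2 \<le> t" "t \<le> 4 + real 0" "norm x \<le> R"
      have "a * ln t powr q \<le> u (fst w) (snd w) / ln 4 powr q * ln 4 powr q"
        using t q a by (intro mult_mono powr_mono2) (auto simp: a_def)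
      also have "\<dots> = u (fst w) (snd w)"
        by simp
      also have "\<dots> \<le> u x t"
        using w(2)[of "(x, t)"] t by simp
      finally show "a * ln t powr q \<le> u x t" .
    qed
  next
    case (Suc n)
    show ?case
    proof (intro allI impI)
      fix x :: "real^2" and t :: real assume t: "2 \<le> t" "t \<le> 4 + real (Suc n)" "norm x \<le> R"
      show "a * ln t powr q \<le> u x t"
      proof (cases "t \<le> 4")
        case True
        then show ?thesis using Suc t by auto
      next
        case False
        have "a * ln (t / 2) powr q \<le> u y s" if "y \<in> ball 0 L" "s \<in> {t / 2..t - 1}" for y s
        proof -
          have "a * ln (t / 2) powr q \<le> a * ln s powr q"
            using that a q False by (intro mult_left_mono powr_mono2) auto
          also have "\<dots> \<le> u y s"
            using that Suc t False R by auto
          finally show ?thesis .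
        qed
        then have "(a * ln (t / 2) powr q) powr p * (pi * L\<^sup>2 * exp (- (R + L)\<^sup>2 / (4 * (t - (t - 1)))) / 8) *
            (ln (t - t / 2) - ln (t - (t - 1))) \<le> u x t * (4 * pi)"
          using t a False by (intro lower_estimate) auto
        then have est: "c * (a * ln (t / 2) powr q) powr p * ln (t / 2) \<le> u x t"
          by (simp add: c_def mult_ac)
        \<comment> \<open>For \<open>t > 4\<close> one has \<open>ln t \<le> 2 * ln (t / 2)\<close>,
          so halving the time costs only \<open>(1/2) powr q\<close>. The identity
          \<open>q * p + 1 = q\<close> turns source strength times logarithm into the same power
          again.\<close>
        have "(1/2) powr q * ln t powr q = (ln t / 2) powr q"
          using False by (simp add: powr_divide powr_one_eq_one)
        also have "\<dots> \<le> ln (t / 2) powr q"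
        proof (rule powr_mono2)
          have "ln t \<le> ln ((t / 2) * (t / 2))"
            using False by (subst ln_le_cancel_iff) auto
          also have "\<dots> = 2 * ln (t / 2)"
            using False by (subst ln_mult) auto
          finally show "ln t / 2 \<le> ln (t / 2)" by simp
        qed (use q False in auto)
        also have "\<dots> = ln (t / 2) powr (q * p) * ln (t / 2)"
          using False q' powr_add[of "ln (t / 2)" "q * p" 1] by simp
        finally have half: "(1/2) powr q * ln t powr q \<le> ln (t / 2) powr (q * p) * ln (t / 2)" .
        have "a * ln t powr q \<le> a powr p * (c * (1/2) powr q) * ln t powr q"
          by (intro mult_right_mono a_le) auto
        also have "\<dots> = a powr p * c * ((1/2) powr q * ln t powr q)"
          by simp
        also have "\<dots> \<le> a powr p * c * (ln (t / 2) powr (q * p) * ln (t / 2))"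
          using c by (intro mult_left_mono half) auto
        also have "\<dots> = c * (a * ln (t / 2) powr q) powr p * ln (t / 2)"
          using a False by (simp add: powr_mult powr_powr)
        also note est
        finally show ?thesis .
      qed
    qed
  qed
  have "a * ln t powr q \<le> u x t" if "2 \<le> t" "norm x \<le> R" for x t
  proof -
    obtain n :: nat where "t \<le> real n"
      using real_arch_simple by blast
    then have "t \<le> 4 + real n"
      by simp
    with bound[of n] that show ?thesis
      by blast
  qed
  with a show thesis
    by (intro that[of a]) (auto simp: q_def)
qed

end

section \<open>The two bounds on a compact set\<close>

theorem theorem1p7:
  fixes p L :: real
    and u\<^sub>0 :: "real^2 \<Rightarrow> real"
    and u :: "real^2 \<Rightarrow> real \<Rightarrow> real"
  assumes "0 < p" and "p < 1" and "0 < L"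
    and "continuous_on UNIV u\<^sub>0"
    and "integrable lborel u\<^sub>0"
    and "bounded (range u\<^sub>0)"
    and "\<forall>x. 0 \<le> u\<^sub>0 x"
    and "\<exists>x. u\<^sub>0 x \<noteq> 0"
    and "\<forall>x\<in>closure (ball 0 L). 0 < u\<^sub>0 x"
    and "bounded_solution p L u\<^sub>0 u"
  shows "\<forall>K. compact K \<longrightarrow>
           sim_uniformly_on K u (\<lambda>x t. (ln t) powr (1 / (1 - p)))"
proof (intro allI impI)
  fix K :: "(real^2) set" assume "compact K"
  then obtain R where R: "\<And>x. x \<in> K \<Longrightarrow> norm x \<le> R"
    using compact_imp_bounded bounded_iff by metis
  interpret weak_solution p L u\<^sub>0 u
    using assms by unfold_locales
  obtain C where C: "0 < C" "\<And>x t. 2 \<le> t \<Longrightarrow> u x t \<le> C * ln t powr (1 / (1 - p))"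
    using upper_bound by blast
  \<comment> \<open>The radius is enlarged to \<open>max R L\<close> because the induction feeds on
    values in the disc of radius \<open>L\<close>.\<close>
  obtain a where a: "0 < a"
      "\<And>x t. 2 \<le> t \<Longrightarrow> norm x \<le> max R L \<Longrightarrow> a * ln t powr (1 / (1 - p)) \<le> u x t"
    using lower_bound[of "max R L"] assms(3,9) by (metis closure_ball less_irrefl max.cobounded2)
  \<comment> \<open>Using \<open>max a C\<close> as upper constant gives the required order of the
    two constants directly.\<close>
  have "\<forall>\<^sub>F t in at_top. \<forall>x\<in>K. a \<le> u x t / ln t powr (1 / (1 - p)) \<and>
      u x t / ln t powr (1 / (1 - p)) \<le> max a C"
    using eventually_ge_at_top[of 2]
  proof eventually_elim
    case (elim t)
    then have pos: "0 < ln t powr (1 / (1 - p))"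
      by simp
    show ?case
    proof
      fix x assume "x \<in> K"
      then have "a \<le> u x t / ln t powr (1 / (1 - p))"
        using a(2)[of t x] R[of x] elim pos by (simp add: pos_le_divide_eq)
      moreover have "u x t / ln t powr (1 / (1 - p)) \<le> C"
        using C(2)[of t x] elim pos by (simp add: pos_divide_le_eq)
      ultimately show "a \<le> u x t / ln t powr (1 / (1 - p)) \<and> u x t / ln t powr (1 / (1 - p)) \<le> max a C"
        by auto
    qed
  qed
  then show "sim_uniformly_on K u (\<lambda>x t. (ln t) powr (1 / (1 - p)))"
    unfolding sim_uniformly_on_def using a(1) by (intro exI[of _ a] exI[of _ "max a C"]) auto
qed

end
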